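(* Let $G$ be a group and assume that its Sidki double $X(G)$ is torsion-free. If the complex group ring $\mathbb{C}(G\times G\times G)$ has no non-trivial idempotent, then the complex group ring $\mathbb{C}X(G)$ does not contain any idempotent other than $0$ and $1$.
   Context: Sidki double: let $G$ be a group, $G^\psi$ a disjoint copy of $G$ and $\psi:G\to G^\psi$ an isomorphism, written $g\mapsto g^\psi$. With $[x,y]=x^{-1}y^{-1}xy$, the Sidki double of $G$ is the group $X(G)=\langle G, G^\psi \mid [g,g^\psi],\ g\in G\rangle$, i.e. the quotient of the free product $G*G^\psi$ by the normal closure of all $[g,g^\psi]$, $g\in G$. An idempotent of a unital ring is called trivial if it equals $0$ or $1$. *)

theory Defs
  imports Complex_Main "HOL-Algebra.Algebra"
begin

section \<open>Free products of two groups\<close>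

text \<open>The free product of two groups is the set of words in the disjoint union of the carriers,
  modulo the least congruence which identifies juxtaposition of two letters of the same factor with
  their product, and the two unit letters with the empty word.\<close>

definition words :: "('a, 'm) monoid_scheme \<Rightarrow> ('b, 'n) monoid_scheme \<Rightarrow> ('a + 'b) list set" where
  "words G H = lists (carrier G <+> carrier H)"

inductive_set word_cong :: "('a, 'm) monoid_scheme \<Rightarrow> ('b, 'n) monoid_scheme
    \<Rightarrow> (('a + 'b) list \<times> ('a + 'b) list) set"
  for G :: "('a, 'm) monoid_scheme" and H :: "('b, 'n) monoid_scheme" where
  wc_refl: "w \<in> words G H \<Longrightarrow> (w, w) \<in> word_cong G H"
| wc_sym: "(u, v) \<in> word_cong G H \<Longrightarrow> (v, u) \<in> word_cong G H"
| wc_trans: "(u, v) \<in> word_cong G H \<Longrightarrow> (v, w) \<in> word_cong G H \<Longrightarrow> (u, w) \<in> word_cong G H"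
| wc_append: "(u, u') \<in> word_cong G H \<Longrightarrow> (v, v') \<in> word_cong G H
    \<Longrightarrow> (u @ v, u' @ v') \<in> word_cong G H"
| wc_Inl_one: "([Inl \<one>\<^bsub>G\<^esub>], []) \<in> word_cong G H"
| wc_Inr_one: "([Inr \<one>\<^bsub>H\<^esub>], []) \<in> word_cong G H"
| wc_Inl_mult: "x \<in> carrier G \<Longrightarrow> y \<in> carrier G
    \<Longrightarrow> ([Inl x, Inl y], [Inl (x \<otimes>\<^bsub>G\<^esub> y)]) \<in> word_cong G H"
| wc_Inr_mult: "x \<in> carrier H \<Longrightarrow> y \<in> carrier H
    \<Longrightarrow> ([Inr x, Inr y], [Inr (x \<otimes>\<^bsub>H\<^esub> y)]) \<in> word_cong G H"

definition word_class :: "('a, 'm) monoid_scheme \<Rightarrow> ('b, 'n) monoid_scheme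
    \<Rightarrow> ('a + 'b) list \<Rightarrow> ('a + 'b) list set" where
  "word_class G H w = word_cong G H `` {w}"

definition free_product :: "('a, 'm) monoid_scheme \<Rightarrow> ('b, 'n) monoid_scheme
    \<Rightarrow> ('a + 'b) list set monoid" where
  "free_product G H =
    \<lparr>carrier = words G H // word_cong G H,
     monoid.mult = (\<lambda>A B. \<Union>u\<in>A. \<Union>v\<in>B. word_class G H (u @ v)),
     monoid.one = word_class G H []\<rparr>"

definition fp_inl :: "('a, 'm) monoid_scheme \<Rightarrow> ('b, 'n) monoid_scheme
    \<Rightarrow> 'a \<Rightarrow> ('a + 'b) list set" where
  "fp_inl G H x = word_class G H [Inl x]"

definition fp_inr :: "('a, 'm) monoid_scheme \<Rightarrow> ('b, 'n) monoid_scheme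
    \<Rightarrow> 'b \<Rightarrow> ('a + 'b) list set" where
  "fp_inr G H y = word_class G H [Inr y]"


section \<open>The Sidki double\<close>

definition normal_closure :: "('a, 'm) monoid_scheme \<Rightarrow> 'a set \<Rightarrow> 'a set" where
  "normal_closure G S = \<Inter>{N. N \<lhd> G \<and> S \<subseteq> N}"

text \<open>The convention is $[x,y]=x^{-1}y^{-1}xy$, unlike for \<^const>\<open>derived_set\<close> in the library.\<close>

definition commutator :: "('a, 'm) monoid_scheme \<Rightarrow> 'a \<Rightarrow> 'a \<Rightarrow> 'a" where
  "commutator G x y = inv\<^bsub>G\<^esub> x \<otimes>\<^bsub>G\<^esub> inv\<^bsub>G\<^esub> y \<otimes>\<^bsub>G\<^esub> x \<otimes>\<^bsub>G\<^esub> y"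

text \<open>The disjoint copy of \<open>G\<close> is the right-hand factor of the free product of \<open>G\<close> with itself,
  and the isomorphism onto the copy is the right-hand inclusion.\<close>

definition sidki_double :: "('a, 'm) monoid_scheme \<Rightarrow> ('a + 'a) list set set monoid" where
  "sidki_double G = free_product G G Mod normal_closure (free_product G G)
     ((\<lambda>g. commutator (free_product G G) (fp_inl G G g) (fp_inr G G g)) ` carrier G)"

definition torsion_free :: "('a, 'm) monoid_scheme \<Rightarrow> bool" where
  "torsion_free G \<longleftrightarrow>
     (\<forall>x\<in>carrier G. \<forall>n::nat. n > 0 \<longrightarrow> x [^]\<^bsub>G\<^esub> n = \<one>\<^bsub>G\<^esub> \<longrightarrow> x = \<one>\<^bsub>G\<^esub>)"


section \<open>Complex group rings\<close>

definition supp :: "('a \<Rightarrow> complex) \<Rightarrow> 'a set" where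
  "supp f = {x. f x \<noteq> 0}"

text \<open>A function stands for the formal linear combination of group elements whose coefficients are
  its values; the product is convolution.\<close>

definition group_ring :: "('a, 'm) monoid_scheme \<Rightarrow> ('a \<Rightarrow> complex) ring" where
  "group_ring G =
    \<lparr>carrier = {f. finite (supp f) \<and> supp f \<subseteq> carrier G},
     monoid.mult = (\<lambda>f g x. \<Sum>y\<in>supp f. \<Sum>z\<in>supp g. if y \<otimes>\<^bsub>G\<^esub> z = x then f y * g z else 0),
     monoid.one = (\<lambda>x. if x = \<one>\<^bsub>G\<^esub> then 1 else 0),
     ring.zero = (\<lambda>_. 0),
     ring.add = (\<lambda>f g x. f x + g x)\<rparr>"

definition idempotents :: "('a, 'm) ring_scheme \<Rightarrow> 'a set" where
  "idempotents R = {e \<in> carrier R. e \<otimes>\<^bsub>R\<^esub> e = e}"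


section \<open>Well-definedness\<close>

context
  fixes G :: "('a, 'm) monoid_scheme" and H :: "('b, 'n) monoid_scheme"
  assumes G: "group G" and H: "group H"
begin

interpretation G: group G by (fact G)
interpretation H: group H by (fact H)

lemma words_append: "u \<in> words G H \<Longrightarrow> v \<in> words G H \<Longrightarrow> u @ v \<in> words G H"
  by (auto simp: words_def)

lemma word_cong_words: "(u, v) \<in> word_cong G H \<Longrightarrow> u \<in> words G H \<and> v \<in> words G H"
  by (induction rule: word_cong.induct) (auto simp: words_def)

lemma equiv_word_cong: "equiv (words G H) (word_cong G H)"
proof (rule equivI)
  show "word_cong G H \<subseteq> words G H \<times> words G H"
    using word_cong_words by auto
  show "refl_on (words G H) (word_cong G H)"
    by (auto intro!: refl_onI wc_refl)
  show "sym (word_cong G H)" by (auto intro!: symI wc_sym)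
  show "trans (word_cong G H)" by (auto intro!: transI intro: wc_trans)
qed

lemma word_class_eq_iff:
  "u \<in> words G H \<Longrightarrow> v \<in> words G H
    \<Longrightarrow> word_class G H u = word_class G H v \<longleftrightarrow> (u, v) \<in> word_cong G H"
  unfolding word_class_def using eq_equiv_class_iff[OF equiv_word_cong] by blast

lemma free_product_carrier: "carrier (free_product G H) = word_class G H ` words G H"
  by (auto simp: free_product_def quotient_def word_class_def)

lemma free_product_mult:
  assumes "u \<in> words G H" "v \<in> words G H"
  shows "word_class G H u \<otimes>\<^bsub>free_product G H\<^esub> word_class G H v = word_class G H (u @ v)"
proof -
  have "word_class G H (u' @ v') = word_class G H (u @ v)"
    if "u' \<in> word_class G H u" "v' \<in> word_class G H v" for u' v'
  proof -
    have *: "(u, u') \<in> word_cong G H" "(v, v') \<in> word_cong G H"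
      using that by (auto simp: word_class_def)
    then have "(u @ v, u' @ v') \<in> word_cong G H" by (rule wc_append)
    with word_class_eq_iff word_cong_words show ?thesis by metis
  qed
  then have "(\<Union>u'\<in>word_class G H u. \<Union>v'\<in>word_class G H v. word_class G H (u' @ v'))
      = (\<Union>u'\<in>word_class G H u. \<Union>v'\<in>word_class G H v. word_class G H (u @ v))"
    by (intro SUP_cong refl)
  moreover have "u \<in> word_class G H u" "v \<in> word_class G H v"
    using assms by (auto simp: word_class_def intro: wc_refl)
  then have "word_class G H u \<noteq> {}" "word_class G H v \<noteq> {}" by blast+
  ultimately show ?thesis by (simp add: free_product_def)
qed

lemma free_product_one: "\<one>\<^bsub>free_product G H\<^esub> = word_class G H []"
  by (simp add: free_product_def)

lemma Nil_words: "[] \<in> words G H"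
  by (simp add: words_def)

lemma word_left_inverse:
  "w \<in> words G H \<Longrightarrow> \<exists>v\<in>words G H. (v @ w, []) \<in> word_cong G H"
proof (induction w)
  case Nil
  then show ?case using Nil_words wc_refl by force
next
  case (Cons a w)
  have a: "a \<in> carrier G <+> carrier H" and w: "w \<in> words G H"
    using Cons.prems by (auto simp: words_def)
  obtain v where v: "v \<in> words G H" "(v @ w, []) \<in> word_cong G H"
    using Cons.IH w by blast
  obtain b where b: "[b] \<in> words G H" "([b, a], []) \<in> word_cong G H"
  proof (cases a)
    case (Inl x)
    with a have x: "x \<in> carrier G" by auto
    have "([Inl (inv\<^bsub>G\<^esub> x), Inl x], []) \<in> word_cong G H"
      by (rule wc_trans[OF wc_Inl_mult[of "inv\<^bsub>G\<^esub> x" _ x]]) (use x in \<open>simp_all add: wc_Inl_one\<close>)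
    with x Inl show ?thesis by (intro that[of "Inl (inv\<^bsub>G\<^esub> x)"]) (auto simp: words_def)
  next
    case (Inr x)
    with a have x: "x \<in> carrier H" by auto
    have "([Inr (inv\<^bsub>H\<^esub> x), Inr x], []) \<in> word_cong G H"
      by (rule wc_trans[OF wc_Inr_mult[of "inv\<^bsub>H\<^esub> x" _ x]]) (use x in \<open>simp_all add: wc_Inr_one\<close>)
    with x Inr show ?thesis by (intro that[of "Inr (inv\<^bsub>H\<^esub> x)"]) (auto simp: words_def)
  qed
  have "(v @ ([b, a] @ w), v @ ([] @ w)) \<in> word_cong G H"
    by (intro wc_append wc_refl v w b)
  then have "((v @ [b]) @ a # w, []) \<in> word_cong G H"
    using v(2) wc_trans by fastforce
  with v b show ?case using words_append by blast
qed

lemma group_free_product: "group (free_product G H)"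
proof (rule groupI)
  fix A assume "A \<in> carrier (free_product G H)"
  then obtain w where w: "w \<in> words G H" "A = word_class G H w"
    by (auto simp: free_product_carrier)
  with word_left_inverse obtain v where v: "v \<in> words G H" "(v @ w, []) \<in> word_cong G H"
    by blast
  then have "word_class G H v \<otimes>\<^bsub>free_product G H\<^esub> A = \<one>\<^bsub>free_product G H\<^esub>"
    using w by (simp add: free_product_mult free_product_one word_class_eq_iff words_append
        Nil_words)
  with v show "\<exists>B\<in>carrier (free_product G H). B \<otimes>\<^bsub>free_product G H\<^esub> A = \<one>\<^bsub>free_product G H\<^esub>"
    by (auto simp: free_product_carrier)
qed (auto simp: free_product_carrier free_product_mult free_product_one words_append Nil_words)

lemma fp_inl_hom: "fp_inl G H \<in> hom G (free_product G H)"
proof (rule homI)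
  fix x y assume xy: "x \<in> carrier G" "y \<in> carrier G"
  then have "fp_inl G H x \<otimes>\<^bsub>free_product G H\<^esub> fp_inl G H y = word_class G H [Inl x, Inl y]"
    unfolding fp_inl_def by (subst free_product_mult) (auto simp: words_def)
  also have "\<dots> = fp_inl G H (x \<otimes>\<^bsub>G\<^esub> y)"
    unfolding fp_inl_def using xy
    by (subst word_class_eq_iff) (auto simp: words_def intro: wc_Inl_mult)
  finally show "fp_inl G H (x \<otimes>\<^bsub>G\<^esub> y) = fp_inl G H x \<otimes>\<^bsub>free_product G H\<^esub> fp_inl G H y" ..
qed (auto simp: fp_inl_def free_product_carrier words_def)

lemma fp_inr_hom: "fp_inr G H \<in> hom H (free_product G H)"
proof (rule homI)
  fix x y assume xy: "x \<in> carrier H" "y \<in> carrier H"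
  then have "fp_inr G H x \<otimes>\<^bsub>free_product G H\<^esub> fp_inr G H y = word_class G H [Inr x, Inr y]"
    unfolding fp_inr_def by (subst free_product_mult) (auto simp: words_def)
  also have "\<dots> = fp_inr G H (x \<otimes>\<^bsub>H\<^esub> y)"
    unfolding fp_inr_def using xy
    by (subst word_class_eq_iff) (auto simp: words_def intro: wc_Inr_mult)
  finally show "fp_inr G H (x \<otimes>\<^bsub>H\<^esub> y) = fp_inr G H x \<otimes>\<^bsub>free_product G H\<^esub> fp_inr G H y" ..
qed (auto simp: fp_inr_def free_product_carrier words_def)

end

lemma (in group) normal_closure_normal:
  assumes "S \<subseteq> carrier G"
  shows "normal_closure G S \<lhd> G"
proof -
  have "carrier G \<lhd> G"
    by (rule normal_invI) (auto intro: subgroup_self)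
  with assms have ne: "{N. N \<lhd> G \<and> S \<subseteq> N} \<noteq> {}" by blast
  show ?thesis unfolding normal_closure_def
  proof (rule normal_invI)
    show "subgroup (\<Inter>{N. N \<lhd> G \<and> S \<subseteq> N}) G"
      using ne by (intro subgroups_Inter) (auto intro: normal_imp_subgroup)
  next
    fix x h assume "x \<in> carrier G" "h \<in> \<Inter>{N. N \<lhd> G \<and> S \<subseteq> N}"
    then show "x \<otimes> h \<otimes> inv x \<in> \<Inter>{N. N \<lhd> G \<and> S \<subseteq> N}"
      using normal.inv_op_closed2 by fastforce
  qed
qed

lemma group_sidki_double:
  assumes "group G"
  shows "group (sidki_double G)"
proof -
  interpret F: group "free_product G G" by (rule group_free_product[OF assms assms])
  have "fp_inl G G g \<in> carrier (free_product G G)" "fp_inr G G g \<in> carrier (free_product G G)"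
    if "g \<in> carrier G" for g
    using that fp_inl_hom[OF assms assms] fp_inr_hom[OF assms assms] by (auto simp: hom_def)
  then have "(\<lambda>g. commutator (free_product G G) (fp_inl G G g) (fp_inr G G g)) ` carrier G
      \<subseteq> carrier (free_product G G)"
    by (auto simp: commutator_def)
  then show ?thesis
    unfolding sidki_double_def by (intro normal.factorgroup_is_group F.normal_closure_normal)
qed

lemma sum_rotate:
  "(\<Sum>p\<in>P. \<Sum>a\<in>A. \<Sum>b\<in>B. F p a b) = (\<Sum>a\<in>A. \<Sum>b\<in>B. \<Sum>p\<in>P. F p a b)"
  by (subst sum.swap[of _ A P], rule sum.cong[OF refl], rule sum.swap)

context group
begin

lemma group_ring_mult_over:
  assumes "finite A" "finite B" "supp f \<subseteq> A" "supp g \<subseteq> B"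
  shows "(f \<otimes>\<^bsub>group_ring G\<^esub> g) x = (\<Sum>y\<in>A. \<Sum>z\<in>B. if y \<otimes> z = x then f y * g z else 0)"
proof -
  have "(f \<otimes>\<^bsub>group_ring G\<^esub> g) x
      = (\<Sum>y\<in>supp f. \<Sum>z\<in>supp g. if y \<otimes> z = x then f y * g z else 0)"
    by (simp add: group_ring_def)
  also have "\<dots> = (\<Sum>y\<in>supp f. \<Sum>z\<in>B. if y \<otimes> z = x then f y * g z else 0)"
    by (intro sum.cong refl sum.mono_neutral_left assms) (auto simp: supp_def)
  also have "\<dots> = (\<Sum>y\<in>A. \<Sum>z\<in>B. if y \<otimes> z = x then f y * g z else 0)"
    by (intro sum.mono_neutral_left assms) (auto simp: supp_def cong: if_cong)
  finally show ?thesis .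
qed

lemma supp_group_ring_mult:
  "supp (f \<otimes>\<^bsub>group_ring G\<^esub> g) \<subseteq> (\<lambda>(y, z). y \<otimes> z) ` (supp f \<times> supp g)"
proof
  fix x assume "x \<in> supp (f \<otimes>\<^bsub>group_ring G\<^esub> g)"
  then have "(\<Sum>y\<in>supp f. \<Sum>z\<in>supp g. if y \<otimes> z = x then f y * g z else 0) \<noteq> 0"
    by (simp add: supp_def group_ring_def)
  then obtain y where y: "y \<in> supp f" "(\<Sum>z\<in>supp g. if y \<otimes> z = x then f y * g z else 0) \<noteq> 0"
    by (meson sum.not_neutral_contains_not_neutral)
  from y(2) obtain z where z: "z \<in> supp g" "(if y \<otimes> z = x then f y * g z else 0) \<noteq> 0"
    by (rule sum.not_neutral_contains_not_neutral)
  from z(2) have "x = y \<otimes> z" by (simp split: if_splits)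
  with y(1) z(1) show "x \<in> (\<lambda>(y, z). y \<otimes> z) ` (supp f \<times> supp g)"
    by (intro image_eqI[of _ _ "(y, z)"]) simp_all
qed

lemma group_ring_mult_closed:
  assumes "f \<in> carrier (group_ring G)" "g \<in> carrier (group_ring G)"
  shows "f \<otimes>\<^bsub>group_ring G\<^esub> g \<in> carrier (group_ring G)"
proof -
  have "finite (supp f \<times> supp g)" "(\<lambda>(y, z). y \<otimes> z) ` (supp f \<times> supp g) \<subseteq> carrier G"
    using assms by (auto simp: group_ring_def)
  with supp_group_ring_mult[of f g]
  have "finite (supp (f \<otimes>\<^bsub>group_ring G\<^esub> g))" "supp (f \<otimes>\<^bsub>group_ring G\<^esub> g) \<subseteq> carrier G"
    by (blast intro: finite_subset)+
  then show ?thesis by (simp add: group_ring_def)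
qed

lemma group_ring_assoc:
  assumes f: "f \<in> carrier (group_ring G)" and g: "g \<in> carrier (group_ring G)"
    and h: "h \<in> carrier (group_ring G)"
  shows "(f \<otimes>\<^bsub>group_ring G\<^esub> g) \<otimes>\<^bsub>group_ring G\<^esub> h = f \<otimes>\<^bsub>group_ring G\<^esub> (g \<otimes>\<^bsub>group_ring G\<^esub> h)"
    (is "?l = ?r")
proof
  fix x
  have fin: "finite (supp f)" "finite (supp g)" "finite (supp h)"
    and sub: "supp f \<subseteq> carrier G" "supp g \<subseteq> carrier G" "supp h \<subseteq> carrier G"
    using f g h by (auto simp: group_ring_def)
  define P where "P = (\<lambda>(y, z). y \<otimes> z) ` (supp f \<times> supp g)"
  define Q where "Q = (\<lambda>(y, z). y \<otimes> z) ` (supp g \<times> supp h)"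
  have finPQ: "finite P" "finite Q" using fin by (auto simp: P_def Q_def)
  let ?t = "\<lambda>a b c. if a \<otimes> b \<otimes> c = x then f a * g b * h c else 0"
  have "?l x = (\<Sum>p\<in>P. \<Sum>c\<in>supp h. if p \<otimes> c = x then (f \<otimes>\<^bsub>group_ring G\<^esub> g) p * h c else 0)"
    using supp_group_ring_mult fin finPQ
    by (intro group_ring_mult_over) (auto simp: P_def)
  also have "\<dots> = (\<Sum>p\<in>P. \<Sum>c\<in>supp h. \<Sum>a\<in>supp f. \<Sum>b\<in>supp g.
      if a \<otimes> b = p then ?t a b c else 0)"
    by (intro sum.cong refl)
      (auto simp: group_ring_def sum_distrib_right intro!: sum.cong sum.neutral)
  also have "\<dots> = (\<Sum>p\<in>P. \<Sum>a\<in>supp f. \<Sum>b\<in>supp g. \<Sum>c\<in>supp h.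
      if a \<otimes> b = p then ?t a b c else 0)"
    by (rule sum.cong[OF refl], rule sum_rotate)
  also have "\<dots> = (\<Sum>a\<in>supp f. \<Sum>b\<in>supp g. \<Sum>p\<in>P. \<Sum>c\<in>supp h.
      if a \<otimes> b = p then ?t a b c else 0)"
    by (rule sum_rotate)
  also have "\<dots> = (\<Sum>a\<in>supp f. \<Sum>b\<in>supp g. \<Sum>c\<in>supp h. \<Sum>p\<in>P.
      if a \<otimes> b = p then ?t a b c else 0)"
    by (rule sum.cong[OF refl], rule sum.cong[OF refl], rule sum.swap)
  also have "\<dots> = (\<Sum>a\<in>supp f. \<Sum>b\<in>supp g. \<Sum>c\<in>supp h. ?t a b c)"
    by (intro sum.cong refl, subst sum.delta'[OF finPQ(1)]) (auto simp: P_def)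
  finally have L: "?l x = (\<Sum>a\<in>supp f. \<Sum>b\<in>supp g. \<Sum>c\<in>supp h. ?t a b c)" .
  have "?r x = (\<Sum>a\<in>supp f. \<Sum>q\<in>Q. if a \<otimes> q = x then f a * (g \<otimes>\<^bsub>group_ring G\<^esub> h) q else 0)"
    using supp_group_ring_mult fin finPQ
    by (intro group_ring_mult_over) (auto simp: Q_def)
  also have "\<dots> = (\<Sum>a\<in>supp f. \<Sum>q\<in>Q. \<Sum>b\<in>supp g. \<Sum>c\<in>supp h.
      if b \<otimes> c = q then (if a \<otimes> q = x then f a * g b * h c else 0) else 0)"
    by (intro sum.cong refl)
      (auto simp: group_ring_def sum_distrib_left mult.assoc intro!: sum.cong sum.neutral)
  also have "\<dots> = (\<Sum>a\<in>supp f. \<Sum>b\<in>supp g. \<Sum>c\<in>supp h. \<Sum>q\<in>Q.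
      if b \<otimes> c = q then (if a \<otimes> q = x then f a * g b * h c else 0) else 0)"
    by (rule sum.cong[OF refl], rule sum_rotate)
  also have "\<dots> = (\<Sum>a\<in>supp f. \<Sum>b\<in>supp g. \<Sum>c\<in>supp h.
      if a \<otimes> (b \<otimes> c) = x then f a * g b * h c else 0)"
    by (intro sum.cong refl, subst sum.delta'[OF finPQ(2)]) (auto simp: Q_def m_assoc)
  also have "\<dots> = (\<Sum>a\<in>supp f. \<Sum>b\<in>supp g. \<Sum>c\<in>supp h. ?t a b c)"
    using sub by (intro sum.cong refl) (auto simp: m_assoc subset_iff)
  finally show "?l x = ?r x" using L by simp
qed

lemma supp_add: "supp (\<lambda>x. f x + g x) \<subseteq> supp f \<union> supp g"
  by (auto simp: supp_def)

lemma ring_group_ring: "ring (group_ring G)"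
proof (rule ringI)
  show "abelian_group (group_ring G)"
  proof (rule abelian_groupI)
    fix f assume "f \<in> carrier (group_ring G)"
    then show "\<exists>g\<in>carrier (group_ring G). g \<oplus>\<^bsub>group_ring G\<^esub> f = \<zero>\<^bsub>group_ring G\<^esub>"
      by (intro bexI[of _ "\<lambda>x. - f x"]) (auto simp: group_ring_def supp_def)
  next
    fix f g assume "f \<in> carrier (group_ring G)" "g \<in> carrier (group_ring G)"
    then show "f \<oplus>\<^bsub>group_ring G\<^esub> g \<in> carrier (group_ring G)"
      using supp_add[of f g] by (auto simp: group_ring_def intro: finite_subset)
  qed (auto simp: group_ring_def supp_def add_ac)
next
  show "Group.monoid (group_ring G)"
  proof (rule monoidI)
    have one: "supp \<one>\<^bsub>group_ring G\<^esub> = {\<one>}" by (auto simp: group_ring_def supp_def)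
    then show "\<one>\<^bsub>group_ring G\<^esub> \<in> carrier (group_ring G)"
      by (simp add: group_ring_def)
    fix f assume "f \<in> carrier (group_ring G)"
    then have f: "finite (supp f)" "supp f \<subseteq> carrier G" by (auto simp: group_ring_def)
    have one1: "\<one>\<^bsub>group_ring G\<^esub> \<one> = 1" by (simp add: group_ring_def)
    show "\<one>\<^bsub>group_ring G\<^esub> \<otimes>\<^bsub>group_ring G\<^esub> f = f"
    proof
      fix x
      have "(\<one>\<^bsub>group_ring G\<^esub> \<otimes>\<^bsub>group_ring G\<^esub> f) x = (\<Sum>z\<in>supp f. if \<one> \<otimes> z = x then f z else 0)"
        by (subst group_ring_mult_over[of "{\<one>}" "supp f"])
          (use f in \<open>auto simp: one one1 intro!: sum.cong\<close>)
      also have "\<dots> = (\<Sum>z\<in>supp f. if z = x then f z else 0)"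
        using f by (intro sum.cong refl) (auto simp: subset_iff)
      also have "\<dots> = f x" using f by (simp add: supp_def)
      finally show "(\<one>\<^bsub>group_ring G\<^esub> \<otimes>\<^bsub>group_ring G\<^esub> f) x = f x" .
    qed
    show "f \<otimes>\<^bsub>group_ring G\<^esub> \<one>\<^bsub>group_ring G\<^esub> = f"
    proof
      fix x
      have "(f \<otimes>\<^bsub>group_ring G\<^esub> \<one>\<^bsub>group_ring G\<^esub>) x = (\<Sum>z\<in>supp f. if z \<otimes> \<one> = x then f z else 0)"
        by (subst group_ring_mult_over[of "supp f" "{\<one>}"])
          (use f in \<open>auto simp: one one1 intro!: sum.cong\<close>)
      also have "\<dots> = (\<Sum>z\<in>supp f. if z = x then f z else 0)"
        using f by (intro sum.cong refl) (auto simp: subset_iff)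
      also have "\<dots> = f x" using f by (simp add: supp_def)
      finally show "(f \<otimes>\<^bsub>group_ring G\<^esub> \<one>\<^bsub>group_ring G\<^esub>) x = f x" .
    qed
  qed (auto simp: group_ring_assoc group_ring_mult_closed)
next
  fix f g h
  assume "f \<in> carrier (group_ring G)" "g \<in> carrier (group_ring G)" "h \<in> carrier (group_ring G)"
  then have fin: "finite (supp f)" "finite (supp g)" "finite (supp h)"
    by (auto simp: group_ring_def)
  have add: "\<And>u v. u \<oplus>\<^bsub>group_ring G\<^esub> v = (\<lambda>x. u x + v x)" by (simp add: group_ring_def)
  let ?A = "supp f \<union> supp g"
  have A: "finite ?A" "supp (\<lambda>x. f x + g x) \<subseteq> ?A" "supp f \<subseteq> ?A" "supp g \<subseteq> ?A"
    using fin by (auto simp: supp_def)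
  show "(f \<oplus>\<^bsub>group_ring G\<^esub> g) \<otimes>\<^bsub>group_ring G\<^esub> h
      = f \<otimes>\<^bsub>group_ring G\<^esub> h \<oplus>\<^bsub>group_ring G\<^esub> g \<otimes>\<^bsub>group_ring G\<^esub> h"
  proof
    fix x
    have "(\<Sum>y\<in>?A. \<Sum>z\<in>supp h. if y \<otimes> z = x then (f y + g y) * h z else 0)
        = (\<Sum>y\<in>?A. \<Sum>z\<in>supp h. if y \<otimes> z = x then f y * h z else 0)
        + (\<Sum>y\<in>?A. \<Sum>z\<in>supp h. if y \<otimes> z = x then g y * h z else 0)"
      unfolding sum.distrib[symmetric] by (intro sum.cong refl) (simp add: distrib_right)
    then show "((f \<oplus>\<^bsub>group_ring G\<^esub> g) \<otimes>\<^bsub>group_ring G\<^esub> h) x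
        = (f \<otimes>\<^bsub>group_ring G\<^esub> h \<oplus>\<^bsub>group_ring G\<^esub> g \<otimes>\<^bsub>group_ring G\<^esub> h) x"
      unfolding add using A fin by (simp only: group_ring_mult_over[OF A(1) fin(3) _ order_refl])
  qed
  show "h \<otimes>\<^bsub>group_ring G\<^esub> (f \<oplus>\<^bsub>group_ring G\<^esub> g)
      = h \<otimes>\<^bsub>group_ring G\<^esub> f \<oplus>\<^bsub>group_ring G\<^esub> h \<otimes>\<^bsub>group_ring G\<^esub> g"
  proof
    fix x
    have "(\<Sum>y\<in>supp h. \<Sum>z\<in>?A. if y \<otimes> z = x then h y * (f z + g z) else 0)
        = (\<Sum>y\<in>supp h. \<Sum>z\<in>?A. if y \<otimes> z = x then h y * f z else 0)
        + (\<Sum>y\<in>supp h. \<Sum>z\<in>?A. if y \<otimes> z = x then h y * g z else 0)"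
      unfolding sum.distrib[symmetric] by (intro sum.cong refl) (simp add: distrib_left)
    then show "(h \<otimes>\<^bsub>group_ring G\<^esub> (f \<oplus>\<^bsub>group_ring G\<^esub> g)) x
        = (h \<otimes>\<^bsub>group_ring G\<^esub> f \<oplus>\<^bsub>group_ring G\<^esub> h \<otimes>\<^bsub>group_ring G\<^esub> g) x"
      unfolding add using A fin by (simp only: group_ring_mult_over[OF fin(3) A(1) order_refl])
  qed
qed

end

end

theory Submission
  imports Defs
begin

text \<open>
  Let \<open>W\<close> be the kernel of the homomorphism from \<open>X(G)\<close> to \<open>G \<times> G \<times> G\<close> sending \<open>g\<close> to \<open>(g, g, 1)\<close> and
  \<open>g\<^sup>\<psi>\<close> to \<open>(1, g, g)\<close>. Comparing \<open>[gh, (gh)\<^sup>\<psi>] = 1\<close> with \<open>[g, g\<^sup>\<psi>] = [h, h\<^sup>\<psi>] = 1\<close> yields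
  \<open>[g, h\<^sup>\<psi>] = [g\<^sup>\<psi>, h]\<close>, and expanding \<open>[g, (hk)\<^sup>\<psi>] = [g\<^sup>\<psi>, hk]\<close> shows that \<open>[g, h\<^sup>\<psi>]\<close> commutes with
  \<open>k\<^sup>\<psi> k\<^sup>-\<^sup>1\<close>. Since \<open>W\<close> lies both in the subgroup generated by the conjugates of the former and in
  the one generated by the latter elements, it is abelian, and it is torsion-free by assumption.

  An idempotent \<open>e\<close> of \<open>\<complex>X(G)\<close> is mapped to \<open>0\<close> or \<open>1\<close> in \<open>\<complex>(G \<times> G \<times> G)\<close>; replacing it by \<open>1 - e\<close>, let
  it be mapped to \<open>0\<close>. Then \<open>e\<close>, being equal to all its powers, lies in every power of the ideal
  generated by the augmentation ideal of \<open>W\<close>, hence is annihilated by all functions on \<open>X(G)\<close> that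
  are polynomial on the cosets of \<open>W\<close>. As homomorphisms from \<open>W\<close> to \<open>\<complex>\<close> separate points, so do these
  functions, and \<open>e = 0\<close>.
\<close>

lemma (in group) inv_mult_cancel:
  assumes "x \<in> carrier G" "y \<in> carrier G"
  shows "inv x \<otimes> (x \<otimes> y) = y" "x \<otimes> (inv x \<otimes> y) = y"
  using assms by (simp_all add: m_assoc[symmetric])

section \<open>Pairing the group ring with functions\<close>

definition pairing :: "('a \<Rightarrow> complex) \<Rightarrow> ('a \<Rightarrow> complex) \<Rightarrow> complex" where
  "pairing f \<phi> = (\<Sum>x\<in>supp f. f x * \<phi> x)"

lemma pairing_superset:
  "finite A \<Longrightarrow> supp f \<subseteq> A \<Longrightarrow> pairing f \<phi> = (\<Sum>x\<in>A. f x * \<phi> x)"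
  unfolding pairing_def by (rule sum.mono_neutral_left) (auto simp: supp_def)

lemma pairing_cong: "(\<And>x. x \<in> supp f \<Longrightarrow> \<phi> x = \<psi> x) \<Longrightarrow> pairing f \<phi> = pairing f \<psi>"
  by (simp add: pairing_def)

lemma pairing_delta: "finite (supp f) \<Longrightarrow> pairing f (\<lambda>x. if x = q then 1 else 0) = f q"
  by (simp add: pairing_def supp_def if_distrib[of "(*) _"] cong: if_cong)

lemma pairing_add:
  assumes "finite (supp f)" "finite (supp g)"
  shows "pairing (\<lambda>x. f x + g x) \<phi> = pairing f \<phi> + pairing g \<phi>"
proof -
  let ?A = "supp f \<union> supp g"
  have "finite ?A" "supp (\<lambda>x. f x + g x) \<subseteq> ?A" "supp f \<subseteq> ?A" "supp g \<subseteq> ?A"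
    using assms by (auto simp: supp_def)
  then show ?thesis
    by (simp add: pairing_superset[of ?A] distrib_right sum.distrib)
qed

lemma pairing_uminus: "pairing (\<lambda>x. - f x) \<phi> = - pairing f \<phi>"
  by (simp add: pairing_def supp_def sum_negf)

text \<open>Summing over the elements of \<open>P\<close> first leaves one term for each pair
  \<open>y\<close>, \<open>z\<close>, as their product is a single element of
  \<open>P\<close>.\<close>

lemma (in group) pairing_group_ring_mult:
  assumes "finite (supp f)" "finite (supp g)"
  shows "pairing (f \<otimes>\<^bsub>group_ring G\<^esub> g) \<phi>
    = pairing f (\<lambda>y. pairing g (\<lambda>z. \<phi> (y \<otimes>\<^bsub>G\<^esub> z)))"
proof -
  define P where "P = (\<lambda>(y, z). y \<otimes>\<^bsub>G\<^esub> z) ` (supp f \<times> supp g)"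
  have P: "finite P" using assms by (simp add: P_def)
  have eq: "(f \<otimes>\<^bsub>group_ring G\<^esub> g) x
      = (\<Sum>y\<in>supp f. \<Sum>z\<in>supp g. if y \<otimes>\<^bsub>G\<^esub> z = x then f y * g z else 0)" for x
    by (simp add: group_ring_def)
  have "supp (f \<otimes>\<^bsub>group_ring G\<^esub> g) \<subseteq> P"
    unfolding P_def by (rule supp_group_ring_mult)
  then have "pairing (f \<otimes>\<^bsub>group_ring G\<^esub> g) \<phi>
      = (\<Sum>x\<in>P. (\<Sum>y\<in>supp f. \<Sum>z\<in>supp g. if y \<otimes>\<^bsub>G\<^esub> z = x then f y * g z else 0) * \<phi> x)"
    by (simp add: pairing_superset[OF P] eq)
  also have "\<dots> = (\<Sum>x\<in>P. \<Sum>y\<in>supp f. \<Sum>z\<in>supp g.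
      if y \<otimes>\<^bsub>G\<^esub> z = x then f y * (g z * \<phi> (y \<otimes>\<^bsub>G\<^esub> z)) else 0)"
    by (simp add: sum_distrib_right if_distrib[of "\<lambda>a. a * _"] mult.assoc cong: if_cong)
  also have "\<dots> = (\<Sum>y\<in>supp f. \<Sum>z\<in>supp g. \<Sum>x\<in>P.
      if y \<otimes>\<^bsub>G\<^esub> z = x then f y * (g z * \<phi> (y \<otimes>\<^bsub>G\<^esub> z)) else 0)"
    by (rule sum_rotate)
  also have "\<dots> = (\<Sum>y\<in>supp f. \<Sum>z\<in>supp g. f y * (g z * \<phi> (y \<otimes>\<^bsub>G\<^esub> z)))"
    by (intro sum.cong refl, subst sum.delta'[OF P]) (auto simp: P_def)
  also have "\<dots> = pairing f (\<lambda>y. pairing g (\<lambda>z. \<phi> (y \<otimes>\<^bsub>G\<^esub> z)))"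
    by (simp add: pairing_def sum_distrib_left)
  finally show ?thesis .
qed

section \<open>Push-forward to group rings, the linear extension of a map\<close>

definition pushforward :: "('a \<Rightarrow> 'b) \<Rightarrow> ('a \<Rightarrow> complex) \<Rightarrow> 'b \<Rightarrow> complex" where
  "pushforward h f q = pairing f (\<lambda>x. if h x = q then 1 else 0)"

lemma supp_pushforward: "supp (pushforward h f) \<subseteq> h ` supp f"
proof
  fix q assume "q \<in> supp (pushforward h f)"
  then have "(\<Sum>x\<in>supp f. f x * (if h x = q then 1 else 0)) \<noteq> 0"
    by (simp add: supp_def pushforward_def pairing_def)
  then show "q \<in> h ` supp f"
    by (force elim!: sum.not_neutral_contains_not_neutral split: if_splits)
qed

lemma finite_supp_pushforward: "finite (supp f) \<Longrightarrow> finite (supp (pushforward h f))"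
  using supp_pushforward finite_subset finite_imageI by metis

text \<open>Push-forward is adjoint to composition with \<open>h\<close>; the support of
  \<open>f\<close> is split into the fibres of \<open>h\<close>.\<close>

lemma pairing_pushforward:
  assumes "finite (supp f)"
  shows "pairing (pushforward h f) \<phi> = pairing f (\<lambda>x. \<phi> (h x))"
proof -
  have "pairing (pushforward h f) \<phi> = (\<Sum>q\<in>h ` supp f. pushforward h f q * \<phi> q)"
    using assms by (intro pairing_superset supp_pushforward) simp
  also have "\<dots> = (\<Sum>q\<in>h ` supp f. \<Sum>x\<in>supp f. if h x = q then f x * \<phi> (h x) else 0)"
    unfolding pushforward_def pairing_def sum_distrib_right by (intro sum.cong refl) auto
  also have "\<dots> = (\<Sum>x\<in>supp f. \<Sum>q\<in>h ` supp f. if h x = q then f x * \<phi> (h x) else 0)"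
    by (rule sum.swap)
  also have "\<dots> = (\<Sum>x\<in>supp f. f x * \<phi> (h x))"
    using assms by (intro sum.cong refl, subst sum.delta') auto
  finally show ?thesis by (simp add: pairing_def)
qed

lemma pushforward_closed:
  assumes "h \<in> hom G H" "f \<in> carrier (group_ring G)"
  shows "pushforward h f \<in> carrier (group_ring H)"
  using assms supp_pushforward[of h f] finite_supp_pushforward[of f h]
  by (auto simp: group_ring_def hom_def Pi_iff dest!: subsetD)

text \<open>A coefficient is a pairing with an indicator function. By the pairing formulas for
  products and push-forwards both sides become the same iterated sum, \<open>h\<close> being
  multiplicative.\<close>

lemma (in group_hom) pushforward_mult:
  assumes f: "f \<in> carrier (group_ring G)" and g: "g \<in> carrier (group_ring G)"
  shows "pushforward h (f \<otimes>\<^bsub>group_ring G\<^esub> g)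
    = pushforward h f \<otimes>\<^bsub>group_ring H\<^esub> pushforward h g"
proof
  fix q
  have fin: "finite (supp f)" "finite (supp g)"
    and sub: "supp f \<subseteq> carrier G" "supp g \<subseteq> carrier G"
    using f g by (auto simp: group_ring_def)
  have "finite (supp (pushforward h f \<otimes>\<^bsub>group_ring H\<^esub> pushforward h g))"
    using H.group_ring_mult_closed[of "pushforward h f" "pushforward h g"]
      pushforward_closed[OF homh f] pushforward_closed[OF homh g]
    by (simp add: group_ring_def)
  then have "(pushforward h f \<otimes>\<^bsub>group_ring H\<^esub> pushforward h g) q
      = pairing (pushforward h f \<otimes>\<^bsub>group_ring H\<^esub> pushforward h g) (\<lambda>x. if x = q then 1 else 0)"
    by (simp add: pairing_delta)
  also have "\<dots> = pairing f (\<lambda>y. pairing g (\<lambda>z. if h y \<otimes>\<^bsub>H\<^esub> h z = q then 1 else 0))"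
    using fin by (simp add: H.pairing_group_ring_mult pairing_pushforward finite_supp_pushforward)
  also have "\<dots> = pairing f (\<lambda>y. pairing g (\<lambda>z. if h (y \<otimes>\<^bsub>G\<^esub> z) = q then 1 else 0))"
    using sub by (intro pairing_cong) (simp add: subset_iff)
  also have "\<dots> = pushforward h (f \<otimes>\<^bsub>group_ring G\<^esub> g) q"
    using fin by (simp add: G.pairing_group_ring_mult pushforward_def)
  finally show "pushforward h (f \<otimes>\<^bsub>group_ring G\<^esub> g) q
    = (pushforward h f \<otimes>\<^bsub>group_ring H\<^esub> pushforward h g) q" by simp
qed

lemma pushforward_one:
  assumes "h \<one>\<^bsub>G\<^esub> = \<one>\<^bsub>H\<^esub>"
  shows "pushforward h \<one>\<^bsub>group_ring G\<^esub> = \<one>\<^bsub>group_ring H\<^esub>"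
proof
  fix q
  have "supp \<one>\<^bsub>group_ring G\<^esub> = {\<one>\<^bsub>G\<^esub>}" by (auto simp: supp_def group_ring_def)
  then show "pushforward h \<one>\<^bsub>group_ring G\<^esub> q = \<one>\<^bsub>group_ring H\<^esub> q"
    using assms by (auto simp: pushforward_def pairing_def) (auto simp: group_ring_def)
qed

lemma (in group) group_ring_minus:
  assumes "f \<in> carrier (group_ring G)" "g \<in> carrier (group_ring G)"
  shows "f \<ominus>\<^bsub>group_ring G\<^esub> g = (\<lambda>x. f x - g x)"
proof -
  interpret R: ring "group_ring G" by (rule ring_group_ring)
  have "\<ominus>\<^bsub>group_ring G\<^esub> g = (\<lambda>x. - g x)"
    using assms by (intro R.minus_equality) (auto simp: group_ring_def supp_def)
  then show ?thesis by (simp add: a_minus_def) (simp add: group_ring_def)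
qed

lemma (in group) pushforward_minus:
  assumes "f \<in> carrier (group_ring G)" "g \<in> carrier (group_ring G)"
  shows "pushforward h (f \<ominus>\<^bsub>group_ring G\<^esub> g) = (\<lambda>q. pushforward h f q - pushforward h g q)"
proof
  fix q
  have "finite (supp f)" "finite (supp (\<lambda>x. - g x))"
    using assms by (auto simp: group_ring_def supp_def)
  from pairing_add[OF this]
  show "pushforward h (f \<ominus>\<^bsub>group_ring G\<^esub> g) q = pushforward h f q - pushforward h g q"
    using assms by (simp add: group_ring_minus pushforward_def pairing_uminus)
qed


section \<open>Polynomial functions along a normal subgroup\<close>

text \<open>\<open>poly_fun S W n \<phi>\<close>: on every coset of \<open>W\<close> the function \<open>\<phi>\<close> is polynomial of degree less than
  \<open>n\<close>, that is, it is killed by any \<open>n\<close> difference operators in directions from \<open>W\<close>. These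
  functions are the annihilator of the \<open>n\<close>-th power of the ideal generated by the augmentation
  ideal of \<open>W\<close>.\<close>

primrec poly_fun :: "('a, 'm) monoid_scheme \<Rightarrow> 'a set \<Rightarrow> nat \<Rightarrow> ('a \<Rightarrow> complex) \<Rightarrow> bool" where
  "poly_fun S W 0 \<phi> \<longleftrightarrow> (\<forall>x\<in>carrier S. \<phi> x = 0)"
| "poly_fun S W (Suc n) \<phi> \<longleftrightarrow> (\<forall>w\<in>W. poly_fun S W n (\<lambda>x. \<phi> (w \<otimes>\<^bsub>S\<^esub> x) - \<phi> x))"

context normal
begin

lemma poly_fun_cong:
  assumes "\<And>x. x \<in> carrier G \<Longrightarrow> \<phi> x = \<psi> x"
  shows "poly_fun G H n \<phi> \<longleftrightarrow> poly_fun G H n \<psi>"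
  using assms
proof (induction n arbitrary: \<phi> \<psi>)
  case (Suc n)
  then have "poly_fun G H n (\<lambda>x. \<phi> (w \<otimes> x) - \<phi> x) \<longleftrightarrow> poly_fun G H n (\<lambda>x. \<psi> (w \<otimes> x) - \<psi> x)"
    if "w \<in> H" for w
    using that by (intro Suc.IH) simp
  then show ?case by simp
qed simp

lemma poly_fun_zero: "poly_fun G H n (\<lambda>_. 0)"
  by (induction n) simp_all

lemma poly_fun_add:
  "poly_fun G H n \<phi> \<Longrightarrow> poly_fun G H n \<psi> \<Longrightarrow> poly_fun G H n (\<lambda>x. \<phi> x + \<psi> x)"
  by (induction n arbitrary: \<phi> \<psi>) (simp_all add: add_diff_add)

lemma poly_fun_scale: "poly_fun G H n \<phi> \<Longrightarrow> poly_fun G H n (\<lambda>x. c * \<phi> x)"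
  by (induction n arbitrary: \<phi>) (simp_all add: right_diff_distrib[symmetric])

lemma poly_fun_pairing:
  assumes "finite (supp f)" "\<And>x. x \<in> supp f \<Longrightarrow> poly_fun G H n (\<phi> x)"
  shows "poly_fun G H n (\<lambda>y. pairing f (\<lambda>x. \<phi> x y))"
proof -
  have "poly_fun G H n (\<lambda>y. \<Sum>x\<in>S. f x * \<phi> x y)" if "finite S" "S \<subseteq> supp f" for S
    using that
    by (induction S rule: finite_induct)
      (auto simp: poly_fun_zero intro!: poly_fun_add poly_fun_scale assms)
  then show ?thesis using assms(1) by (simp add: pairing_def)
qed

text \<open>Differencing by \<open>w\<close> after translation by \<open>x\<close> is translation of
  the difference by \<open>x \<otimes> w \<otimes> inv x\<close>, which is in \<open>H\<close> by
  normality.\<close>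

lemma poly_fun_translate:
  assumes "poly_fun G H n \<phi>" "x \<in> carrier G"
  shows "poly_fun G H n (\<lambda>y. \<phi> (x \<otimes> y))"
  using assms(1)
proof (induction n arbitrary: \<phi>)
  case (Suc n)
  show ?case unfolding poly_fun.simps
  proof
    fix w assume w: "w \<in> H"
    define v where "v = x \<otimes> w \<otimes> inv x"
    have v: "v \<in> H" using w assms(2) by (simp add: v_def inv_op_closed2)
    have "poly_fun G H n (\<lambda>y. \<phi> (v \<otimes> (x \<otimes> y)) - \<phi> (x \<otimes> y))"
      using Suc.prems v by (intro Suc.IH[of "\<lambda>y. \<phi> (v \<otimes> y) - \<phi> y"]) simp
    moreover have "v \<otimes> (x \<otimes> y) = x \<otimes> (w \<otimes> y)" if "y \<in> carrier G" for y
      using that w assms(2) by (simp add: v_def m_assoc inv_mult_cancel)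
    ultimately show "poly_fun G H n (\<lambda>y. \<phi> (x \<otimes> (w \<otimes> y)) - \<phi> (x \<otimes> y))"
      by (subst poly_fun_cong[of _ "\<lambda>y. \<phi> (v \<otimes> (x \<otimes> y)) - \<phi> (x \<otimes> y)"]) simp_all
  qed
qed (use assms(2) in simp)

text \<open>Degree less than one means invariance under left multiplication by \<open>H\<close>, so
  \<open>b\<close> passes through all difference operators.\<close>

lemma poly_fun_mult_invariant:
  assumes "poly_fun G H (Suc 0) b" "poly_fun G H n \<phi>"
  shows "poly_fun G H n (\<lambda>x. b x * \<phi> x)"
  using assms(2)
proof (induction n arbitrary: \<phi>)
  case (Suc n)
  show ?case unfolding poly_fun.simps
  proof
    fix w assume w: "w \<in> H"
    have "poly_fun G H n (\<lambda>x. b x * (\<phi> (w \<otimes> x) - \<phi> x))"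
      using Suc.prems w by (intro Suc.IH) simp
    then show "poly_fun G H n (\<lambda>x. b (w \<otimes> x) * \<phi> (w \<otimes> x) - b x * \<phi> x)"
      by (subst poly_fun_cong[of _ "\<lambda>x. b x * (\<phi> (w \<otimes> x) - \<phi> x)"])
        (use assms(1) w in \<open>auto simp: right_diff_distrib\<close>)
  qed
qed simp

text \<open>The discrete Leibniz rule: the difference of the product is \<open>a\<close> times the
  difference of \<open>\<phi>\<close>, settled by induction, plus the difference of
  \<open>a\<close>, which is invariant, times a translate of \<open>\<phi>\<close>.\<close>

lemma poly_fun_mult_affine:
  assumes a: "poly_fun G H (Suc (Suc 0)) a" and "poly_fun G H n \<phi>"
  shows "poly_fun G H (Suc n) (\<lambda>x. a x * \<phi> x)"
  using assms(2)
proof (induction n arbitrary: \<phi>)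
  case (Suc n)
  show ?case unfolding poly_fun.simps(2)[of _ _ "Suc n"]
  proof
    fix w assume w: "w \<in> H"
    have "poly_fun G H (Suc n) (\<lambda>x. a x * (\<phi> (w \<otimes> x) - \<phi> x))"
      using Suc.prems w by (intro Suc.IH) simp
    moreover have "poly_fun G H (Suc 0) (\<lambda>x. a (w \<otimes> x) - a x)"
      using a w by simp
    then have "poly_fun G H (Suc n) (\<lambda>x. (a (w \<otimes> x) - a x) * \<phi> (w \<otimes> x))"
      using Suc.prems w by (intro poly_fun_mult_invariant poly_fun_translate) simp_all
    ultimately have "poly_fun G H (Suc n)
        (\<lambda>x. a x * (\<phi> (w \<otimes> x) - \<phi> x) + (a (w \<otimes> x) - a x) * \<phi> (w \<otimes> x))"
      by (rule poly_fun_add)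
    then show "poly_fun G H (Suc n) (\<lambda>x. a (w \<otimes> x) * \<phi> (w \<otimes> x) - a x * \<phi> x)"
      by (simp add: algebra_simps)
  qed
qed simp

end

section \<open>Idempotents with zero image and their pairings with polynomial functions\<close>

lemma (in group_hom) kernelI: "x \<in> carrier G \<Longrightarrow> h x = \<one>\<^bsub>H\<^esub> \<Longrightarrow> x \<in> kernel G H h"
  by (simp add: kernel_def)

lemma (in group_hom) kernelD: "x \<in> kernel G H h \<Longrightarrow> h x = \<one>\<^bsub>H\<^esub>"
  by (simp add: kernel_def)

text \<open>On each fibre of \<open>h\<close> the coefficients of \<open>f\<close> add up to zero.
  Hence subtracting \<open>\<phi> (r x \<otimes> y)\<close>, where \<open>r x\<close> depends only
  on \<open>h x\<close>, does not change the pairing, but it replaces \<open>\<phi>\<close> by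
  translates of its differences in kernel directions.\<close>

lemma (in group_hom) poly_fun_contract:
  assumes f: "f \<in> carrier (group_ring G)" and f0: "pushforward h f = \<zero>\<^bsub>group_ring H\<^esub>"
    and \<phi>: "poly_fun G (kernel G H h) (Suc n) \<phi>"
  shows "poly_fun G (kernel G H h) n (\<lambda>y. pairing f (\<lambda>x. \<phi> (x \<otimes> y)))"
proof -
  interpret W: normal "kernel G H h" G by (rule normal_kernel)
  have fin: "finite (supp f)" and sub: "supp f \<subseteq> carrier G"
    using f by (auto simp: group_ring_def)
  define r where "r x = (SOME z. z \<in> carrier G \<and> h z = h x)" for x
  have r: "r x \<in> carrier G" "h (r x) = h x" if "x \<in> carrier G" for x
    using someI[of "\<lambda>z. z \<in> carrier G \<and> h z = h x" x] that by (simp_all add: r_def)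
  have r_pairing: "pairing f (\<lambda>x. \<phi> (r x \<otimes> y)) = 0" for y
  proof -
    have "pairing f (\<lambda>x. \<phi> (r x \<otimes> y))
        = pairing (pushforward h f) (\<lambda>q. \<phi> ((SOME z. z \<in> carrier G \<and> h z = q) \<otimes> y))"
      using fin by (simp add: pairing_pushforward r_def)
    then show ?thesis by (simp add: f0 pairing_def) (simp add: group_ring_def)
  qed
  have "poly_fun G (kernel G H h) n (\<lambda>y. pairing f (\<lambda>x. \<phi> (x \<otimes> y) - \<phi> (r x \<otimes> y)))"
  proof (rule W.poly_fun_pairing[OF fin])
    fix x assume "x \<in> supp f"
    with sub have x: "x \<in> carrier G" by blast
    note rx = r[OF x]
    define v where "v = x \<otimes> inv (r x)"
    have v: "v \<in> kernel G H h" using x rx by (intro kernelI) (simp_all add: v_def)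
    then have "poly_fun G (kernel G H h) n (\<lambda>y. \<phi> (v \<otimes> (r x \<otimes> y)) - \<phi> (r x \<otimes> y))"
      using \<phi> rx(1) by (intro W.poly_fun_translate[of _ "\<lambda>y. \<phi> (v \<otimes> y) - \<phi> y"]) simp_all
    moreover have "v \<otimes> (r x \<otimes> y) = x \<otimes> y" if "y \<in> carrier G" for y
      using x rx(1) that by (simp add: v_def G.m_assoc G.inv_mult_cancel)
    ultimately show "poly_fun G (kernel G H h) n (\<lambda>y. \<phi> (x \<otimes> y) - \<phi> (r x \<otimes> y))"
      by (subst W.poly_fun_cong[of _ "\<lambda>y. \<phi> (v \<otimes> (r x \<otimes> y)) - \<phi> (r x \<otimes> y)"]) simp_all
  qed
  moreover have "pairing f (\<lambda>x. \<phi> (x \<otimes> y) - \<phi> (r x \<otimes> y)) = pairing f (\<lambda>x. \<phi> (x \<otimes> y))" for y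
    using r_pairing[of y] by (simp add: pairing_def right_diff_distrib sum_subtractf)
  ultimately show ?thesis by simp
qed

text \<open>As \<open>e\<close> is its own square, pairing it with \<open>\<phi>\<close> is pairing
  it with the contraction of \<open>\<phi>\<close> by \<open>e\<close>, whose degree bound is one
  less; at bound zero the function vanishes on the carrier.\<close>

lemma (in group_hom) idempotent_pairing_poly_fun:
  assumes e: "e \<in> idempotents (group_ring G)" and "pushforward h e = \<zero>\<^bsub>group_ring H\<^esub>"
    and "poly_fun G (kernel G H h) n \<phi>"
  shows "pairing e \<phi> = 0"
  using assms(3)
proof (induction n arbitrary: \<phi>)
  case 0
  with e have "\<phi> x = 0" if "x \<in> supp e" for x
    using that by (auto simp: idempotents_def group_ring_def)
  then show ?case by (simp add: pairing_def)
next
  case (Suc n)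
  have carr: "e \<in> carrier (group_ring G)" and ee: "e \<otimes>\<^bsub>group_ring G\<^esub> e = e"
    using e by (auto simp: idempotents_def)
  have fin: "finite (supp e)" using carr by (simp add: group_ring_def)
  have "pairing e \<phi> = pairing e (\<lambda>x. pairing e (\<lambda>y. \<phi> (x \<otimes> y)))"
    using G.pairing_group_ring_mult[OF fin fin, of \<phi>] ee by simp
  \<comment> \<open>The sums are exchanged because \<open>poly_fun_contract\<close> contracts the
    left factor.\<close>
  also have "\<dots> = pairing e (\<lambda>y. pairing e (\<lambda>x. \<phi> (x \<otimes> y)))"
    unfolding pairing_def sum_distrib_left by (subst sum.swap) (simp add: mult.left_commute)
  also have "\<dots> = 0"
    by (intro Suc.IH poly_fun_contract carr assms Suc.prems)
  finally show ?case .
qed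

text \<open>If \<open>e x0\<close> is nonzero, a polynomial function that is nonzero at
  \<open>x0\<close> and zero on the rest of the support of \<open>e\<close> has nonzero pairing with
  \<open>e\<close>, a contradiction. It is the indicator of the kernel coset of \<open>x0\<close>
  times an affine factor, obtained from \<open>sep\<close>, for each other support point in that
  coset.\<close>

lemma (in group_hom) idempotent_eq_zero:
  assumes e: "e \<in> idempotents (group_ring G)" and e0: "pushforward h e = \<zero>\<^bsub>group_ring H\<^esub>"
    and sep: "\<And>w. w \<in> kernel G H h \<Longrightarrow> w \<noteq> \<one> \<Longrightarrow>
      \<exists>l. (\<forall>u\<in>kernel G H h. \<forall>v\<in>kernel G H h. l (u \<otimes> v) = l u + l v) \<and> l w \<noteq> (0 :: complex)"
  shows "e = \<zero>\<^bsub>group_ring G\<^esub>"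
proof (rule ccontr)
  interpret W: normal "kernel G H h" G by (rule normal_kernel)
  assume "e \<noteq> \<zero>\<^bsub>group_ring G\<^esub>"
  then obtain x0 where x0: "e x0 \<noteq> 0" by (auto simp: group_ring_def)
  have fin: "finite (supp e)" and sub: "supp e \<subseteq> carrier G"
    using e by (auto simp: group_ring_def idempotents_def)
  have x0G: "x0 \<in> carrier G" using x0 sub by (auto simp: supp_def)
  have w_coset: "h (w \<otimes> x) = h x" if "w \<in> kernel G H h" "x \<in> carrier G" for w x
    using that by (simp add: kernelD)
  have "\<exists>n \<phi>. poly_fun G (kernel G H h) n \<phi> \<and> \<phi> x0 \<noteq> 0
      \<and> (\<forall>x\<in>carrier G. h x \<noteq> h x0 \<longrightarrow> \<phi> x = 0) \<and> (\<forall>x\<in>S. \<phi> x = 0)"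
    if "finite S" "S \<subseteq> {x \<in> carrier G. h x = h x0} - {x0}" for S
    using that
  proof (induction S rule: finite_induct)
    case empty
    have "poly_fun G (kernel G H h) 1 (\<lambda>x. if h x = h x0 then 1 else 0)"
      by (simp add: w_coset del: hom_mult)
    then show ?case by (intro exI[of _ 1] exI[of _ "\<lambda>x. if h x = h x0 then 1 else 0"]) simp
  next
    case (insert s S)
    then obtain n \<phi> where \<phi>: "poly_fun G (kernel G H h) n \<phi>" "\<phi> x0 \<noteq> 0"
      "\<forall>x\<in>carrier G. h x \<noteq> h x0 \<longrightarrow> \<phi> x = 0" "\<forall>x\<in>S. \<phi> x = 0"
      by auto
    have s: "s \<in> carrier G" "h s = h x0" "s \<noteq> x0" using insert.prems by auto
    let ?w = "s \<otimes> inv x0"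
    have "?w \<in> kernel G H h" using s x0G by (intro kernelI) simp_all
    moreover have "?w \<noteq> \<one>" using s x0G by (simp add: G.inv_solve_right')
    ultimately obtain l where
      "(\<forall>u\<in>kernel G H h. \<forall>v\<in>kernel G H h. l (u \<otimes> v) = l u + l v) \<and> l ?w \<noteq> (0 :: complex)"
      using sep[of ?w] by (elim meta_impE exE) assumption+
    then have l: "\<And>u v. u \<in> kernel G H h \<Longrightarrow> v \<in> kernel G H h \<Longrightarrow> l (u \<otimes> v) = l u + l v"
      and lw: "l ?w \<noteq> 0"
      by auto
    have l1: "l \<one> = 0" using l[of \<one> \<one>] W.one_closed by simp
    \<comment> \<open>On the coset of \<open>x0\<close> a homomorphism is shifted so as to vanish at
      \<open>s\<close>; the value at \<open>x0\<close> is \<open>- l ?w\<close>. The difference in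
      direction \<open>w\<close> is the constant \<open>l w\<close> there and zero elsewhere, whence
      degree less than two.\<close>
    define a where "a x = (if h x = h x0 then l (x \<otimes> inv x0) - l ?w else 0)" for x
    have "poly_fun G (kernel G H h) (Suc (Suc 0)) a"
    proof -
      have "a (w \<otimes> x) - a x = (if h x = h x0 then l w else 0)"
        if "w \<in> kernel G H h" "x \<in> carrier G" for w x
      proof (cases "h x = h x0")
        case True
        then have "x \<otimes> inv x0 \<in> kernel G H h" using that x0G by (intro kernelI) simp_all
        moreover have "w \<otimes> x \<otimes> inv x0 = w \<otimes> (x \<otimes> inv x0)"
          using that x0G by (simp add: G.m_assoc)
        ultimately show ?thesis using that True l by (simp add: a_def w_coset del: hom_mult)
      qed (use that in \<open>simp add: a_def w_coset del: hom_mult\<close>)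
      then show ?thesis by (simp add: w_coset del: hom_mult)
    qed
    then have "poly_fun G (kernel G H h) (Suc n) (\<lambda>x. a x * \<phi> x)"
      using \<phi>(1) by (rule W.poly_fun_mult_affine)
    moreover have "a x0 \<noteq> 0" using lw l1 x0G by (simp add: a_def)
    moreover have "a s = 0" by (simp add: a_def)
    ultimately show ?case using \<phi>
      by (intro exI[of _ "Suc n"] exI[of _ "\<lambda>x. a x * \<phi> x"]) auto
  qed
  from this[of "{x \<in> supp e. h x = h x0} - {x0}"] fin sub
  obtain n \<phi> where \<phi>: "poly_fun G (kernel G H h) n \<phi>" "\<phi> x0 \<noteq> 0"
      "\<forall>x\<in>carrier G. h x \<noteq> h x0 \<longrightarrow> \<phi> x = 0" "\<forall>x\<in>{x \<in> supp e. h x = h x0} - {x0}. \<phi> x = 0"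
    by (auto simp: subset_iff)
  have "pairing e \<phi> = pairing e (\<lambda>x. if x = x0 then \<phi> x0 else 0)"
    using \<phi> sub by (intro pairing_cong) auto
  also have "\<dots> = e x0 * \<phi> x0"
    using fin x0 by (simp add: pairing_def supp_def if_distrib[of "(*) _"] cong: if_cong)
  finally show False
    using idempotent_pairing_poly_fun[OF e e0 \<phi>(1)] x0 \<phi>(2) by simp
qed


section \<open>Additive characters of torsion-free abelian groups\<close>

context comm_group
begin

text \<open>Homomorphisms from subgroups into \<open>\<complex>\<close>, represented by their graphs.\<close>

definition partial_character :: "('a \<times> complex) set \<Rightarrow> bool" where
  "partial_character K \<longleftrightarrow> K \<subseteq> carrier G \<times> UNIV \<and> (\<one>, 0) \<in> K
    \<and> (\<forall>(u, a)\<in>K. \<forall>(v, b)\<in>K. (u \<otimes> v, a + b) \<in> K)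
    \<and> (\<forall>(u, a)\<in>K. (inv u, - a) \<in> K) \<and> (\<forall>a. (\<one>, a) \<in> K \<longrightarrow> a = 0)"

lemma partial_characterI:
  assumes "\<And>u a. (u, a) \<in> K \<Longrightarrow> u \<in> carrier G" "(\<one>, 0) \<in> K"
    "\<And>u a v b. (u, a) \<in> K \<Longrightarrow> (v, b) \<in> K \<Longrightarrow> (u \<otimes> v, a + b) \<in> K"
    "\<And>u a. (u, a) \<in> K \<Longrightarrow> (inv u, - a) \<in> K" "\<And>a. (\<one>, a) \<in> K \<Longrightarrow> a = 0"
  shows "partial_character K"
  using assms unfolding partial_character_def by auto

lemma partial_characterD:
  assumes "partial_character K"
  shows "(u, a) \<in> K \<Longrightarrow> u \<in> carrier G" "(\<one>, 0) \<in> K"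
    "(u, a) \<in> K \<Longrightarrow> (v, b) \<in> K \<Longrightarrow> (u \<otimes> v, a + b) \<in> K"
    "(u, a) \<in> K \<Longrightarrow> (inv u, - a) \<in> K" "(\<one>, a) \<in> K \<Longrightarrow> a = 0"
  using assms unfolding partial_character_def by blast+

lemma partial_character_int_pow:
  assumes K: "partial_character K" and u: "(u, a) \<in> K"
  shows "(u [^] (m :: int), of_int m * a) \<in> K"
proof -
  have nat: "(u [^] n, of_nat n * a) \<in> K" for n :: nat
  proof (induction n)
    case (Suc n)
    from partial_characterD(3)[OF K Suc u] show ?case by (simp add: algebra_simps)
  qed (use partial_characterD(2)[OF K] in simp)
  show ?thesis
  proof (cases m rule: int_cases2)
    case (nonneg n)
    then show ?thesis using nat[of n] by (simp add: int_pow_int)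
  next
    case (nonpos n)
    then show ?thesis using partial_characterD(4)[OF K nat[of n]] partial_characterD(1)[OF K u]
      by (simp add: int_pow_neg int_pow_int)
  qed
qed

text \<open>The quotient of the two pairs has first component \<open>\<one>\<close>, so the last
  clause of \<open>partial_character\<close> makes its second component zero.\<close>

lemma partial_character_unique:
  assumes K: "partial_character K" and "(u, a) \<in> K" "(u, b) \<in> K"
  shows "a = b"
proof -
  have "(u \<otimes> inv u, a + - b) \<in> K"
    using assms by (intro partial_characterD(3)[OF K] partial_characterD(4)[OF K])
  then show ?thesis
    using partial_characterD(1,5)[OF K] assms(2) by fastforce
qed

text \<open>The extension sends \<open>z\<close> to \<open>c\<close>. The hypothesis on
  \<open>c\<close> is agreement with \<open>K\<close> on those powers of \<open>z\<close> where
  \<open>K\<close> is already defined, which makes the extended graph single-valued.\<close>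

lemma partial_character_adjoin:
  assumes K: "partial_character K" and z: "z \<in> carrier G"
    and c: "\<And>m :: int. \<And>a. (z [^] m, a) \<in> K \<Longrightarrow> a = of_int m * c"
  shows "partial_character {(u \<otimes> z [^] m, a + of_int m * c) | u a m. (u, a) \<in> K \<and> m \<in> (UNIV :: int set)}"
    (is "partial_character ?K")
proof (rule partial_characterI)
  note D = partial_characterD[OF K]
  have memI: "(v, b) \<in> ?K" if "(u, a) \<in> K" "v = u \<otimes> z [^] m" "b = a + of_int m * c"
    for u v a b and m :: int
    using that by blast
  show "p \<in> carrier G" if "(p, a) \<in> ?K" for p a using that D(1) z by auto
  show "(\<one>, 0) \<in> ?K" by (rule memI[OF D(2), of _ 0]) simp_all
  show "(p \<otimes> q, a + b) \<in> ?K" if "(p, a) \<in> ?K" "(q, b) \<in> ?K" for p q a b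
  proof -
    from that obtain u a' and m :: int and v b' and n :: int where *: "(u, a') \<in> K" "(v, b') \<in> K"
      "p = u \<otimes> z [^] m" "a = a' + of_int m * c" "q = v \<otimes> z [^] n" "b = b' + of_int n * c" by blast
    then have "u \<in> carrier G" "v \<in> carrier G" using D(1) by blast+
    then show ?thesis using * z
      by (intro memI[OF D(3)[OF *(1,2)], of _ "m + n"])
        (simp_all add: int_pow_mult m_ac algebra_simps)
  qed
  show "(inv p, - a) \<in> ?K" if "(p, a) \<in> ?K" for p a
  proof -
    from that obtain u a' and m :: int
      where *: "(u, a') \<in> K" "p = u \<otimes> z [^] m" "a = a' + of_int m * c" by blast
    then have "u \<in> carrier G" using D(1) by blast
    then show ?thesis using * z
      by (intro memI[OF D(4)[OF *(1)], of _ "- m"]) (simp_all add: int_pow_neg inv_mult)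
  qed
  show "a = 0" if "(\<one>, a) \<in> ?K" for a
  proof -
    from that obtain u a' and m :: int
      where *: "(u, a') \<in> K" "\<one> = u \<otimes> z [^] m" "a = a' + of_int m * c" by blast
    then have "u \<in> carrier G" using D(1) by blast
    then have "inv u = z [^] m" using *(2) z by (metis int_pow_closed inv_equality m_comm)
    then have "- a' = of_int m * c" using D(4)[OF *(1)] c by simp
    then show ?thesis using *(3) by (metis add.right_inverse)
  qed
qed

text \<open>By torsion-freeness \<open>w [^] m\<close> is trivial for \<open>m = 0\<close> only, so
  the character of the trivial subgroup extends by sending \<open>w\<close> to 1.\<close>

lemma exists_partial_character:
  assumes tf: "torsion_free G" and w: "w \<in> carrier G" "w \<noteq> \<one>"
  shows "\<exists>K. partial_character K \<and> (w, 1) \<in> K"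
proof -
  have triv: "partial_character {(\<one>, 0)}" by (simp add: partial_character_def)
  have m0: "m = 0" if "w [^] m = \<one>" for m :: int
  proof (rule ccontr)
    assume "m \<noteq> 0"
    then have "nat \<bar>m\<bar> > 0" by simp
    moreover have "w [^] nat \<bar>m\<bar> = \<one>"
      using that w by (cases m rule: int_cases2) (auto simp: int_pow_int int_pow_neg)
    ultimately show False using tf w unfolding torsion_free_def by blast
  qed
  have "partial_character {(u \<otimes> w [^] m, a + of_int m * 1) | u a m.
      (u, a) \<in> {(\<one>, 0)} \<and> m \<in> (UNIV :: int set)}" (is "partial_character ?K")
    using m0 w by (intro partial_character_adjoin[OF triv]) auto
  moreover have "(w, 1) \<in> ?K" using w
    by (auto intro!: exI[of _ "1 :: int"])
  ultimately show ?thesis by blast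
qed

text \<open>For Zorn's lemma: two pairs of the union lie in a common member of the chain.\<close>

lemma partial_character_chain:
  assumes ne: "C \<noteq> {}" and ch: "subset.chain {K. partial_character K} C"
  shows "partial_character (\<Union>C)"
proof (rule partial_characterI)
  have pc: "partial_character K" if "K \<in> C" for K
    using ch that by (auto simp: subset.chain_def)
  show "(u \<otimes> v, a + b) \<in> \<Union>C" if uv: "(u, a) \<in> \<Union>C" "(v, b) \<in> \<Union>C" for u v a b
  proof -
    obtain K L where KL: "K \<in> C" "(u, a) \<in> K" "L \<in> C" "(v, b) \<in> L" using uv by blast
    moreover have "K \<subseteq> L \<or> L \<subseteq> K" using ch KL(1,3) by (auto simp: subset_chain_def)
    ultimately obtain P where "P \<in> C" "(u, a) \<in> P" "(v, b) \<in> P" by blast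
    then show ?thesis using pc partial_characterD(3) by blast
  qed
  show "(inv u, - a) \<in> \<Union>C" if "(u, a) \<in> \<Union>C" for u a
    using that pc partial_characterD(4) by blast
  show "u \<in> carrier G" if "(u, a) \<in> \<Union>C" for u a using that pc partial_characterD(1) by blast
  show "(\<one>, 0) \<in> \<Union>C" using ne pc partial_characterD(2) by blast
  show "a = 0" if "(\<one>, a) \<in> \<Union>C" for a using that pc partial_characterD(5) by blast
qed

text \<open>Divisibility of the complex numbers provides a compatible value \<open>c\<close> at
  \<open>z\<close>; by maximality the extension by it is \<open>K\<close> itself.\<close>

lemma maximal_partial_character_total:
  assumes K: "partial_character K" and max: "\<And>L. partial_character L \<Longrightarrow> K \<subseteq> L \<Longrightarrow> L = K"
    and z: "z \<in> carrier G"
  shows "\<exists>a. (z, a) \<in> K"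
proof -
  obtain c where c: "\<And>m :: int. \<And>a. (z [^] m, a) \<in> K \<Longrightarrow> a = of_int m * c"
  proof (cases "\<exists>n :: int. \<exists>b. n \<noteq> 0 \<and> (z [^] n, b) \<in> K")
    case True
    then obtain n :: int and b where nb: "n \<noteq> 0" "(z [^] n, b) \<in> K" by blast
    \<comment> \<open>The value at \<open>z [^] n\<close> dictates \<open>c\<close>. It is
      compatible with the value at \<open>z [^] m\<close> since both determine the value at
      \<open>z [^] (m * n)\<close>.\<close>
    have "a = of_int m * (b / of_int n)" if "(z [^] m, a) \<in> K" for m :: int and a
    proof -
      have "(z [^] (m * n), of_int n * a) \<in> K" "(z [^] (n * m), of_int m * b) \<in> K"
        using partial_character_int_pow[OF K that, of n] partial_character_int_pow[OF K nb(2), of m] z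
        by (simp_all add: int_pow_pow)
      then have "of_int n * a = of_int m * b"
        using partial_character_unique[OF K] by (simp add: mult.commute)
      then show ?thesis using nb(1) by (simp add: field_simps)
    qed
    then show ?thesis by (rule that)
  next
    case False
    \<comment> \<open>Only the exponent 0 occurs, so any \<open>c\<close> is compatible; 0 is
      chosen.\<close>
    have "a = of_int m * 0" if "(z [^] m, a) \<in> K" for m :: int and a
    proof -
      have "m = 0" using False that by blast
      then show ?thesis using that partial_characterD(5)[OF K] by simp
    qed
    then show ?thesis by (rule that)
  qed
  let ?L = "{(u \<otimes> z [^] m, a + of_int m * c) | u a m. (u, a) \<in> K \<and> m \<in> (UNIV :: int set)}"
  have "K \<subseteq> ?L"
  proof
    fix p assume "p \<in> K"
    moreover obtain u a where "p = (u, a)" by force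
    ultimately show "p \<in> ?L" using partial_characterD(1)[OF K]
      by (auto intro!: exI[of _ u] exI[of _ a] exI[of _ "0 :: int"])
  qed
  with partial_character_adjoin[OF K z c] max have "?L = K" by blast
  moreover have "(z, c) \<in> ?L" using partial_characterD(2)[OF K] z
    by (auto intro!: exI[of _ \<one>] exI[of _ "0 :: complex"] exI[of _ "1 :: int"])
  ultimately show ?thesis by blast
qed

text \<open>A maximal extension of a partial character with value 1 at \<open>w\<close> is defined
  everywhere.\<close>

theorem exists_additive_character:
  assumes "torsion_free G" "w \<in> carrier G" "w \<noteq> \<one>"
  shows "\<exists>l. (\<forall>u\<in>carrier G. \<forall>v\<in>carrier G. l (u \<otimes> v) = l u + l v) \<and> l w \<noteq> (0 :: complex)"
proof -
  obtain K0 where K0: "partial_character K0" "(w, 1) \<in> K0"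
    using exists_partial_character[OF assms] by blast
  let ?A = "{K. partial_character K \<and> K0 \<subseteq> K}"
  have "\<exists>M\<in>?A. \<forall>S\<in>?A. M \<subseteq> S \<longrightarrow> S = M"
  proof (rule subset_Zorn_nonempty)
    fix C assume C: "C \<noteq> {}" "subset.chain ?A C"
    then have "subset.chain {K. partial_character K} C" by (auto simp: subset.chain_def)
    then have "partial_character (\<Union>C)" by (rule partial_character_chain[OF C(1)])
    moreover have "K0 \<subseteq> \<Union>C" using C unfolding subset.chain_def by blast
    ultimately show "\<Union>C \<in> ?A" by simp
  qed (use K0 in blast)
  then obtain K where K: "partial_character K" "K0 \<subseteq> K" and KA: "\<forall>L\<in>?A. K \<subseteq> L \<longrightarrow> L = K"
    by (auto elim: bexE)
  have max: "L = K" if "partial_character L" "K \<subseteq> L" for L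
    using KA K(2) that by auto
  define l where "l z = (THE a. (z, a) \<in> K)" for z
  have lI: "l z = a" if "(z, a) \<in> K" for z a
    unfolding l_def using that partial_character_unique[OF K(1)] by blast
  have lK: "(z, l z) \<in> K" if "z \<in> carrier G" for z
    using maximal_partial_character_total[OF K(1) max that] lI by blast
  have "l (u \<otimes> v) = l u + l v" if "u \<in> carrier G" "v \<in> carrier G" for u v
    using that by (intro lI partial_characterD(3)[OF K(1)] lK)
  moreover have "l w = 1" using K0 K by (intro lI) blast
  ultimately show ?thesis by (intro exI[of _ l]) simp
qed

end


section \<open>Maps out of free products and Sidki doubles\<close>

text \<open>Words are evaluated in \<open>K\<close> letter by letter; every clause of
  \<open>word_cong\<close> preserves the value, which therefore descends to classes.\<close>

lemma free_product_lift:
  assumes G: "group G" and H: "group H" and K: "group K"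
    and \<alpha>: "\<alpha> \<in> hom G K" and \<beta>: "\<beta> \<in> hom H K"
  obtains h where "h \<in> hom (free_product G H) K"
    "\<And>x. x \<in> carrier G \<Longrightarrow> h (fp_inl G H x) = \<alpha> x"
    "\<And>y. y \<in> carrier H \<Longrightarrow> h (fp_inr G H y) = \<beta> y"
proof -
  interpret K: group K by (rule K)
  interpret \<alpha>: group_hom G K \<alpha> using G K \<alpha> by (simp add: group_hom_def group_hom_axioms_def)
  interpret \<beta>: group_hom H K \<beta> using H K \<beta> by (simp add: group_hom_def group_hom_axioms_def)
  define ev where "ev w = foldr (\<lambda>s k. case_sum \<alpha> \<beta> s \<otimes>\<^bsub>K\<^esub> k) w \<one>\<^bsub>K\<^esub>" for w
  have ev_closed: "ev w \<in> carrier K" if "w \<in> words G H" for w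
    using that by (induction w) (auto simp: ev_def words_def)
  have ev_append: "ev (u @ v) = ev u \<otimes>\<^bsub>K\<^esub> ev v" if "u \<in> words G H" "v \<in> words G H" for u v
    using that(1)
  proof (induction u)
    case Nil
    then show ?case using ev_closed[OF that(2)] by (simp add: ev_def)
  next
    case (Cons s u)
    then have "u \<in> words G H" by (simp add: words_def)
    then show ?case using Cons ev_closed[OF that(2)] ev_closed[of u]
      by (auto simp: ev_def words_def K.m_assoc)
  qed
  have ev_cong: "ev u = ev v" if "(u, v) \<in> word_cong G H" for u v
    using that
  proof (induction rule: word_cong.induct)
    case (wc_append u u' v v')
    then show ?case using word_cong_words[OF G H] ev_append by metis
  qed (auto simp: ev_def K.m_assoc)
  define h where "h A = the_elem (ev ` A)" for A
  have h: "h (word_class G H w) = ev w" if "w \<in> words G H" for w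
  proof -
    have "w \<in> word_class G H w" using that by (auto simp: word_class_def intro: wc_refl)
    moreover have "ev v = ev w" if "v \<in> word_class G H w" for v
      using that ev_cong by (auto simp: word_class_def)
    ultimately have "ev ` word_class G H w = {ev w}" by blast
    then show ?thesis by (simp add: h_def)
  qed
  have "h \<in> hom (free_product G H) K"
    by (rule homI) (auto simp: free_product_carrier[OF G H] free_product_mult[OF G H] h ev_closed
        words_append[OF G H] ev_append)
  moreover have "h (fp_inl G H x) = \<alpha> x" if "x \<in> carrier G" for x
    using that unfolding fp_inl_def by (subst h) (auto simp: words_def ev_def)
  moreover have "h (fp_inr G H y) = \<beta> y" if "y \<in> carrier H" for y
    using that unfolding fp_inr_def by (subst h) (auto simp: words_def ev_def)
  ultimately show ?thesis by (rule that)
qed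

lemma free_product_induct [consumes 3, case_names one inl inr]:
  assumes G: "group G" and H: "group H" and A: "A \<in> carrier (free_product G H)"
    and one: "P \<one>\<^bsub>free_product G H\<^esub>"
    and inl: "\<And>x A. x \<in> carrier G \<Longrightarrow> A \<in> carrier (free_product G H) \<Longrightarrow> P A
      \<Longrightarrow> P (fp_inl G H x \<otimes>\<^bsub>free_product G H\<^esub> A)"
    and inr: "\<And>y A. y \<in> carrier H \<Longrightarrow> A \<in> carrier (free_product G H) \<Longrightarrow> P A
      \<Longrightarrow> P (fp_inr G H y \<otimes>\<^bsub>free_product G H\<^esub> A)"
  shows "P A"
proof -
  have "P (word_class G H w)" if "w \<in> words G H" for w
    using that
  proof (induction w)
    case Nil
    then show ?case using one by (simp add: free_product_one[OF G H])
  next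
    case (Cons s w)
    then have s: "[s] \<in> words G H" and w: "w \<in> words G H" by (auto simp: words_def)
    have carr: "word_class G H w \<in> carrier (free_product G H)"
      using w by (simp add: free_product_carrier[OF G H])
    have eq: "word_class G H (s # w) = word_class G H [s] \<otimes>\<^bsub>free_product G H\<^esub> word_class G H w"
      using free_product_mult[OF G H s w] by simp
    show ?case
    proof (cases s)
      case (Inl x)
      with s have "x \<in> carrier G" by (auto simp: words_def)
      from inl[OF this carr Cons.IH[OF w]] show ?thesis unfolding eq by (simp add: Inl fp_inl_def)
    next
      case (Inr y)
      with s have "y \<in> carrier H" by (auto simp: words_def)
      from inr[OF this carr Cons.IH[OF w]] show ?thesis unfolding eq by (simp add: Inr fp_inr_def)
    qed
  qed
  then show ?thesis using A by (auto simp: free_product_carrier[OF G H])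
qed


section \<open>Groups generated by two elementwise commuting copies\<close>

context group
begin

text \<open>Moving \<open>B\<close> and then \<open>b\<close> across in \<open>ab\<close>, with the
  help of \<open>bB\<close>, gives \<open>*\<close>; multiplying by the inverse of
  \<open>a \<otimes> A\<close> turns its sides into the two commutators. When \<open>A\<close> and
  \<open>B\<close> are the second copies of \<open>a\<close> and \<open>b\<close>, the hypotheses
  are the relations for \<open>a\<close>, \<open>b\<close> and their product.\<close>

lemma commutator_swap:
  assumes carr: "a \<in> carrier G" "A \<in> carrier G" "b \<in> carrier G" "B \<in> carrier G"
    and aA: "a \<otimes> A = A \<otimes> a" and bB: "b \<otimes> B = B \<otimes> b"
    and ab: "a \<otimes> b \<otimes> (A \<otimes> B) = A \<otimes> B \<otimes> (a \<otimes> b)"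
  shows "commutator G A (inv b) = commutator G a (inv B)"
proof -
  have *: "a \<otimes> b \<otimes> A \<otimes> inv b = A \<otimes> B \<otimes> a \<otimes> inv B"
  proof -
    have "a \<otimes> b \<otimes> A \<otimes> B = A \<otimes> B \<otimes> (a \<otimes> b)" using carr ab by (simp add: m_assoc)
    then have "a \<otimes> b \<otimes> A = A \<otimes> B \<otimes> (a \<otimes> b) \<otimes> inv B"
      using carr inv_solve_right[of "a \<otimes> b \<otimes> A" "A \<otimes> B \<otimes> (a \<otimes> b)" B] by simp
    also have "\<dots> = A \<otimes> B \<otimes> a \<otimes> (b \<otimes> inv B)" using carr by (simp add: m_assoc)
    also have "b \<otimes> inv B = inv B \<otimes> b"
      using carr bB by (metis inv_closed inv_solve_left inv_solve_right m_assoc m_closed)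
    also have "A \<otimes> B \<otimes> a \<otimes> (inv B \<otimes> b) = A \<otimes> B \<otimes> a \<otimes> inv B \<otimes> b"
      using carr by (simp add: m_assoc)
    finally show ?thesis using carr by (simp add: inv_solve_right')
  qed
  have "commutator G A (inv b) = inv (a \<otimes> A) \<otimes> (a \<otimes> b \<otimes> A \<otimes> inv b)"
    using carr by (simp add: commutator_def inv_mult_group m_assoc inv_mult_cancel)
  also have "\<dots> = inv (A \<otimes> a) \<otimes> (A \<otimes> B \<otimes> a \<otimes> inv B)" by (simp only: * aA)
  also have "\<dots> = commutator G a (inv B)"
    using carr by (simp add: commutator_def inv_mult_group m_assoc inv_mult_cancel)
  finally show ?thesis .
qed

lemma commutator_mult_right:
  assumes "x \<in> carrier G" "y \<in> carrier G" "z \<in> carrier G"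
  shows "commutator G x (y \<otimes> z) = commutator G x z \<otimes> (inv z \<otimes> commutator G x y \<otimes> z)"
  using assms by (simp add: commutator_def inv_mult_group m_assoc inv_mult_cancel)

text \<open>Conjugate \<open>comm\<close> by \<open>y\<close>. This shifts a conjugation to the
  other element: stability of \<open>Z\<close> is reduced to conjugates of twists, and that of
  \<open>M\<close> to that of \<open>Z\<close>.\<close>

lemma conj_commute:
  assumes carr: "y \<in> carrier G" "z \<in> carrier G" "m \<in> carrier G"
    and comm: "z \<otimes> (inv y \<otimes> m \<otimes> y) = inv y \<otimes> m \<otimes> y \<otimes> z"
  shows "y \<otimes> z \<otimes> inv y \<otimes> m = m \<otimes> (y \<otimes> z \<otimes> inv y)"
proof -
  have "y \<otimes> z \<otimes> inv y \<otimes> m = y \<otimes> (z \<otimes> (inv y \<otimes> m \<otimes> y)) \<otimes> inv y"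
    using carr by (simp add: m_assoc)
  also have "\<dots> = y \<otimes> (inv y \<otimes> m \<otimes> y \<otimes> z) \<otimes> inv y" by (simp only: comm)
  also have "\<dots> = m \<otimes> (y \<otimes> z \<otimes> inv y)"
    using carr by (simp add: m_assoc inv_mult_cancel)
  finally show ?thesis .
qed

end

text \<open>\<open>p\<close>, \<open>r\<close> and \<open>q\<close>, in this order, are the coordinates of a homomorphism into \<open>G \<times> G \<times> G\<close>.\<close>

locale commuting_copies = group S + G: group G + p: group_hom S G p + q: group_hom S G q
    + r: group_hom S G r
  for S :: "('x, 'n) monoid_scheme" (structure) and G :: "('a, 'm) monoid_scheme"
    and p q r :: "'x \<Rightarrow> 'a" +
  fixes i j :: "'a \<Rightarrow> 'x"
  assumes i_hom: "i \<in> hom G S" and j_hom: "j \<in> hom G S"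
    and i_j_commute: "g \<in> carrier G \<Longrightarrow> i g \<otimes> j g = j g \<otimes> i g"
    and generated: "x \<in> carrier S \<Longrightarrow> P \<one>
      \<Longrightarrow> (\<And>g x. g \<in> carrier G \<Longrightarrow> x \<in> carrier S \<Longrightarrow> P x \<Longrightarrow> P (i g \<otimes> x))
      \<Longrightarrow> (\<And>g x. g \<in> carrier G \<Longrightarrow> x \<in> carrier S \<Longrightarrow> P x \<Longrightarrow> P (j g \<otimes> x)) \<Longrightarrow> P x"
    and p_i: "g \<in> carrier G \<Longrightarrow> p (i g) = g" and p_j: "g \<in> carrier G \<Longrightarrow> p (j g) = \<one>\<^bsub>G\<^esub>"
    and q_i: "g \<in> carrier G \<Longrightarrow> q (i g) = \<one>\<^bsub>G\<^esub>" and q_j: "g \<in> carrier G \<Longrightarrow> q (j g) = g"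
    and r_i: "g \<in> carrier G \<Longrightarrow> r (i g) = g" and r_j: "g \<in> carrier G \<Longrightarrow> r (j g) = g"
begin

sublocale i: group_hom G S i
  by unfold_locales (rule i_hom)

sublocale j: group_hom G S j
  by unfold_locales (rule j_hom)

section \<open>Twists, commutators, and the sets centralising them\<close>

definition twist :: "'a \<Rightarrow> 'x" where
  "twist g = j g \<otimes> inv (i g)"

lemma twist_closed [simp]: "g \<in> carrier G \<Longrightarrow> twist g \<in> carrier S"
  by (simp add: twist_def)

lemma twist_eq:
  assumes "g \<in> carrier G"
  shows "twist g = inv (i g) \<otimes> j g"
proof -
  have "inv (i g) \<otimes> (i g \<otimes> j g) \<otimes> inv (i g) = inv (i g) \<otimes> (j g \<otimes> i g) \<otimes> inv (i g)"
    using assms by (simp only: i_j_commute)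
  then show ?thesis using assms by (simp add: twist_def m_assoc inv_mult_cancel)
qed

text \<open>An element commuting with all twists thereby commutes with their conjugates by either
  copy, as \<open>conj_Z\<close> needs.\<close>

lemma conj_twist:
  assumes "g \<in> carrier G" "c \<in> carrier G"
  shows "inv (i g) \<otimes> twist c \<otimes> i g = twist g \<otimes> twist (inv\<^bsub>G\<^esub> g \<otimes>\<^bsub>G\<^esub> c)"
    "inv (j g) \<otimes> twist c \<otimes> j g = twist (inv\<^bsub>G\<^esub> g \<otimes>\<^bsub>G\<^esub> c) \<otimes> twist g"
  using assms unfolding twist_eq[OF assms(1)]
  by (simp_all add: twist_def inv_mult_group m_assoc inv_mult_cancel)

lemma commutator_i_j:
  assumes "a \<in> carrier G" "b \<in> carrier G"
  shows "commutator S (j a) (i b) = commutator S (i a) (j b)"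
proof -
  let ?b = "inv\<^bsub>G\<^esub> b"
  have "commutator S (j a) (inv (i ?b)) = commutator S (i a) (inv (j ?b))"
    using assms i_j_commute[of a] i_j_commute[of ?b] i_j_commute[of "a \<otimes>\<^bsub>G\<^esub> ?b"]
    by (intro commutator_swap) simp_all
  then show ?thesis using assms by simp
qed

text \<open>Expanding \<open>commutator_i_j\<close> for the product of \<open>b\<close> and
  \<open>c\<close> and cancelling the equal commutators of \<open>a\<close> and \<open>c\<close>
  shows that conjugation by \<open>i c\<close> and by \<open>j c\<close> has the same effect on
  \<open>k\<close>.\<close>

lemma commutator_twist_commute:
  assumes "a \<in> carrier G" "b \<in> carrier G" "c \<in> carrier G"
  shows "commutator S (j a) (i b) \<otimes> twist c = twist c \<otimes> commutator S (j a) (i b)"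
proof -
  define k where "k = commutator S (j a) (i b)"
  have k: "k \<in> carrier S" "k = commutator S (i a) (j b)"
    using assms commutator_i_j by (simp_all add: k_def) (simp add: commutator_def)
  have cc: "commutator S (j a) (i c) \<in> carrier S" using assms by (simp add: commutator_def)
  have "commutator S (j a) (i c) \<otimes> (inv (i c) \<otimes> k \<otimes> i c) = commutator S (j a) (i (b \<otimes>\<^bsub>G\<^esub> c))"
    using assms by (simp add: commutator_mult_right k_def)
  also have "\<dots> = commutator S (i a) (j (b \<otimes>\<^bsub>G\<^esub> c))" using assms by (intro commutator_i_j) simp_all
  also have "\<dots> = commutator S (j a) (i c) \<otimes> (inv (j c) \<otimes> k \<otimes> j c)"
    using assms by (simp add: commutator_mult_right k(2) commutator_i_j)
  finally have eq: "inv (i c) \<otimes> k \<otimes> i c = inv (j c) \<otimes> k \<otimes> j c"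
    using assms k(1) cc by simp
  have "k \<otimes> twist c = j c \<otimes> (inv (j c) \<otimes> k \<otimes> j c) \<otimes> inv (i c)"
    using assms k(1) by (simp add: twist_def m_assoc inv_mult_cancel)
  also have "\<dots> = twist c \<otimes> k"
    unfolding eq[symmetric] using assms k(1) by (simp add: twist_def m_assoc)
  finally show ?thesis by (simp add: k_def)
qed

text \<open>Described by the properties to be proved for the common kernel of \<open>p\<close> and
  \<open>q\<close>, so that closure under products and conjugation and membership of commutators
  suffice. That this kernel lies in \<open>Z\<close> comes out in
  \<open>kernels_commute\<close>.\<close>

definition Z :: "'x set" where
  "Z = {z \<in> carrier S. p z = \<one>\<^bsub>G\<^esub> \<and> q z = \<one>\<^bsub>G\<^esub> \<and> (\<forall>c\<in>carrier G. z \<otimes> twist c = twist c \<otimes> z)}"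

text \<open>The counterpart for the kernel of \<open>r\<close>; the last condition in
  \<open>Z\<close> puts the twists into \<open>M\<close>.\<close>

definition M :: "'x set" where
  "M = {m \<in> carrier S. r m = \<one>\<^bsub>G\<^esub> \<and> (\<forall>z\<in>Z. m \<otimes> z = z \<otimes> m)}"

lemma commute_mult:
  assumes "u \<in> carrier S" "v \<in> carrier S" "m \<in> carrier S"
    and "u \<otimes> m = m \<otimes> u" "v \<otimes> m = m \<otimes> v"
  shows "u \<otimes> v \<otimes> m = m \<otimes> (u \<otimes> v)"
  using assms by (metis m_assoc)

lemma Z_mult: "u \<in> Z \<Longrightarrow> v \<in> Z \<Longrightarrow> u \<otimes> v \<in> Z"
  by (auto simp: Z_def intro: commute_mult)

lemma M_mult: "u \<in> M \<Longrightarrow> v \<in> M \<Longrightarrow> u \<otimes> v \<in> M"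
  by (auto simp: M_def Z_def intro: commute_mult)

lemma twist_M: "g \<in> carrier G \<Longrightarrow> twist g \<in> M"
  by (auto simp: M_def Z_def) (simp add: twist_def r_i r_j)

lemma commutator_Z:
  assumes "a \<in> carrier G" "b \<in> carrier G"
  shows "commutator S (j a) (i b) \<in> Z"
proof -
  have "p (commutator S (j a) (i b)) = \<one>\<^bsub>G\<^esub>" "q (commutator S (j a) (i b)) = \<one>\<^bsub>G\<^esub>"
    using assms by (simp_all add: commutator_def p_i p_j q_i q_j)
  then show ?thesis using assms
    by (auto simp: Z_def commutator_twist_commute) (simp add: commutator_def)
qed

lemma conj_Z:
  assumes g: "g \<in> carrier G" and z: "z \<in> Z"
  shows "i g \<otimes> z \<otimes> inv (i g) \<in> Z" "j g \<otimes> z \<otimes> inv (j g) \<in> Z"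
proof -
  have zS: "z \<in> carrier S" "p z = \<one>\<^bsub>G\<^esub>" "q z = \<one>\<^bsub>G\<^esub>"
    and zt: "\<And>c. c \<in> carrier G \<Longrightarrow> twist c \<otimes> z = z \<otimes> twist c"
    using z by (auto simp: Z_def)
  have z2: "z \<otimes> (twist c \<otimes> twist d) = twist c \<otimes> twist d \<otimes> z"
    if "c \<in> carrier G" "d \<in> carrier G" for c d
    using that zS zt by (intro commute_mult[symmetric]) simp_all
  show "i g \<otimes> z \<otimes> inv (i g) \<in> Z" "j g \<otimes> z \<otimes> inv (j g) \<in> Z"
    using g zS by (auto simp: Z_def p_i p_j q_i q_j conj_twist z2 intro!: conj_commute)
qed

lemma conj_M:
  assumes g: "g \<in> carrier G" and m: "m \<in> M"
  shows "i g \<otimes> m \<otimes> inv (i g) \<in> M" "j g \<otimes> m \<otimes> inv (j g) \<in> M"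
proof -
  have mS: "m \<in> carrier S" "r m = \<one>\<^bsub>G\<^esub>" and mz: "\<And>z. z \<in> Z \<Longrightarrow> m \<otimes> z = z \<otimes> m"
    using m by (auto simp: M_def)
  have "inv (i g) \<otimes> z \<otimes> i g \<in> Z" "inv (j g) \<otimes> z \<otimes> j g \<in> Z" if "z \<in> Z" for z
    using conj_Z[of "inv\<^bsub>G\<^esub> g" z] that g by simp_all
  moreover have "z \<in> carrier S" if "z \<in> Z" for z using that by (simp add: Z_def)
  ultimately show "i g \<otimes> m \<otimes> inv (i g) \<in> M" "j g \<otimes> m \<otimes> inv (j g) \<in> M"
    using g mS by (auto simp: M_def r_i r_j mz intro!: conj_commute)
qed

text \<open>A prefix \<open>i g\<close> conjugates \<open>z\<close> and multiplies \<open>a\<close>.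
  A prefix \<open>j g\<close> conjugates \<open>z\<close> and then has to pass \<open>i a\<close>,
  at the cost of a commutator absorbed by \<open>Z\<close>.\<close>

lemma Z_factorization:
  assumes "x \<in> carrier S"
  shows "\<exists>z\<in>Z. \<exists>a\<in>carrier G. \<exists>b\<in>carrier G. x = z \<otimes> i a \<otimes> j b"
  using assms
proof (rule generated)
  show "\<exists>z\<in>Z. \<exists>a\<in>carrier G. \<exists>b\<in>carrier G. \<one> = z \<otimes> i a \<otimes> j b"
    by (intro bexI[of _ \<one>] bexI[of _ "\<one>\<^bsub>G\<^esub>"]) (simp_all add: Z_def)
next
  fix g x assume g: "g \<in> carrier G"
    and "\<exists>z\<in>Z. \<exists>a\<in>carrier G. \<exists>b\<in>carrier G. x = z \<otimes> i a \<otimes> j b"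
  then obtain z a b where x: "z \<in> Z" "a \<in> carrier G" "b \<in> carrier G" "x = z \<otimes> i a \<otimes> j b"
    by blast
  have zS: "z \<in> carrier S" using x by (simp add: Z_def)
  have "i g \<otimes> x = (i g \<otimes> z \<otimes> inv (i g)) \<otimes> i (g \<otimes>\<^bsub>G\<^esub> a) \<otimes> j b"
    using g x zS by (simp add: m_assoc inv_mult_cancel)
  then show "\<exists>z\<in>Z. \<exists>a\<in>carrier G. \<exists>b\<in>carrier G. i g \<otimes> x = z \<otimes> i a \<otimes> j b"
    using conj_Z(1)[OF g x(1)] g x by blast
next
  fix g x assume g: "g \<in> carrier G"
    and "\<exists>z\<in>Z. \<exists>a\<in>carrier G. \<exists>b\<in>carrier G. x = z \<otimes> i a \<otimes> j b"
  then obtain z a b where x: "z \<in> Z" "a \<in> carrier G" "b \<in> carrier G" "x = z \<otimes> i a \<otimes> j b"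
    by blast
  \<comment> \<open>With inverted arguments the commutator satisfies
    \<open>j g \<otimes> i a = ?k \<otimes> i a \<otimes> j g\<close>.\<close>
  let ?k = "commutator S (j (inv\<^bsub>G\<^esub> g)) (i (inv\<^bsub>G\<^esub> a))"
  have zS: "z \<in> carrier S" using x by (simp add: Z_def)
  have "j g \<otimes> x = (j g \<otimes> z \<otimes> inv (j g)) \<otimes> ?k \<otimes> i a \<otimes> j (g \<otimes>\<^bsub>G\<^esub> b)"
    using g x zS by (simp add: m_assoc inv_mult_cancel commutator_def)
  moreover have "(j g \<otimes> z \<otimes> inv (j g)) \<otimes> ?k \<in> Z"
    using g x by (intro Z_mult conj_Z commutator_Z) simp_all
  ultimately show "\<exists>z\<in>Z. \<exists>a\<in>carrier G. \<exists>b\<in>carrier G. j g \<otimes> x = z \<otimes> i a \<otimes> j b"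
    using g x by blast
qed

text \<open>A prefix \<open>j g\<close> is rewritten as \<open>twist g \<otimes> i g\<close>, so
  that the second copy disappears into \<open>M\<close>.\<close>

lemma M_factorization:
  assumes "x \<in> carrier S"
  shows "\<exists>m\<in>M. \<exists>a\<in>carrier G. x = m \<otimes> i a"
  using assms
proof (rule generated)
  show "\<exists>m\<in>M. \<exists>a\<in>carrier G. \<one> = m \<otimes> i a"
    by (intro bexI[of _ \<one>] bexI[of _ "\<one>\<^bsub>G\<^esub>"]) (auto simp: M_def Z_def)
next
  fix g x assume g: "g \<in> carrier G" and "\<exists>m\<in>M. \<exists>a\<in>carrier G. x = m \<otimes> i a"
  then obtain m a where x: "m \<in> M" "a \<in> carrier G" "x = m \<otimes> i a" by blast
  have mS: "m \<in> carrier S" using x by (simp add: M_def)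
  have "i g \<otimes> x = (i g \<otimes> m \<otimes> inv (i g)) \<otimes> i (g \<otimes>\<^bsub>G\<^esub> a)"
    using g x mS by (simp add: m_assoc inv_mult_cancel)
  then show "\<exists>m\<in>M. \<exists>a\<in>carrier G. i g \<otimes> x = m \<otimes> i a"
    using conj_M(1)[OF g x(1)] g x by blast
next
  fix g x assume g: "g \<in> carrier G" and "\<exists>m\<in>M. \<exists>a\<in>carrier G. x = m \<otimes> i a"
  then obtain m a where x: "m \<in> M" "a \<in> carrier G" "x = m \<otimes> i a" by blast
  have mS: "m \<in> carrier S" using x by (simp add: M_def)
  have "j g \<otimes> x = (j g \<otimes> m \<otimes> inv (j g)) \<otimes> twist g \<otimes> i (g \<otimes>\<^bsub>G\<^esub> a)"
    using g x mS by (simp add: m_assoc inv_mult_cancel twist_def)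
  moreover have "(j g \<otimes> m \<otimes> inv (j g)) \<otimes> twist g \<in> M"
    using g x by (intro M_mult conj_M twist_M) simp_all
  ultimately show "\<exists>m\<in>M. \<exists>a\<in>carrier G. j g \<otimes> x = m \<otimes> i a"
    using g x by blast
qed

text \<open>The maps \<open>p\<close>, \<open>q\<close> and \<open>r\<close> read off the factors
  from the two copies in the factorizations, so these are trivial and \<open>x \<in> Z\<close>,
  \<open>y \<in> M\<close>. Elements of the common kernel of all three maps may serve as
  \<open>x\<close> and as \<open>y\<close>, so that kernel is commutative.\<close>

lemma kernels_commute:
  assumes x: "x \<in> carrier S" "p x = \<one>\<^bsub>G\<^esub>" "q x = \<one>\<^bsub>G\<^esub>" and y: "y \<in> carrier S" "r y = \<one>\<^bsub>G\<^esub>"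
  shows "x \<otimes> y = y \<otimes> x"
proof -
  obtain z a b where z: "z \<in> Z" "a \<in> carrier G" "b \<in> carrier G" "x = z \<otimes> i a \<otimes> j b"
    using Z_factorization x(1) by blast
  then have "a = \<one>\<^bsub>G\<^esub>" "b = \<one>\<^bsub>G\<^esub>" using x by (auto simp: Z_def p_i p_j q_i q_j)
  then have "x \<in> Z" using z by (simp add: Z_def)
  moreover obtain m c where m: "m \<in> M" "c \<in> carrier G" "y = m \<otimes> i c"
    using M_factorization y(1) by blast
  then have "c = \<one>\<^bsub>G\<^esub>" using y by (auto simp: M_def r_i)
  then have "y \<in> M" using m by (simp add: M_def)
  ultimately show ?thesis by (simp add: M_def)
qed

end


section \<open>The representation of the Sidki double in the third power\<close>

text \<open>The map on the free product kills each defining commutator, since in every coordinate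
  the two entries are equal or one of them is trivial. The induced map has the common kernel of its
  coordinates as kernel.\<close>

lemma sidki_double_third_power:
  fixes G :: "('a, 'm) monoid_scheme"
  assumes G: "group G"
  obtains h where "h \<in> hom (sidki_double G) (G \<times>\<times> G \<times>\<times> G)"
    "\<And>x y. x \<in> kernel (sidki_double G) (G \<times>\<times> G \<times>\<times> G) h
      \<Longrightarrow> y \<in> kernel (sidki_double G) (G \<times>\<times> G \<times>\<times> G) h
      \<Longrightarrow> x \<otimes>\<^bsub>sidki_double G\<^esub> y = y \<otimes>\<^bsub>sidki_double G\<^esub> x"
proof -
  interpret G: group G by (rule G)
  define F where "F = free_product G G"
  define T where "T = G \<times>\<times> G \<times>\<times> G"
  define S where "S = sidki_double G"
  interpret F: group F unfolding F_def by (rule group_free_product[OF G G])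
  interpret T: group T unfolding T_def by (intro DirProd_group G)
  interpret S: group S unfolding S_def by (rule group_sidki_double[OF G])
  have inl: "fp_inl G G \<in> hom G F" and inr: "fp_inr G G \<in> hom G F"
    unfolding F_def by (rule fp_inl_hom[OF G G], rule fp_inr_hom[OF G G])
  have "(\<lambda>g. (g, g, \<one>\<^bsub>G\<^esub>)) \<in> hom G T" "(\<lambda>g. (\<one>\<^bsub>G\<^esub>, g, g)) \<in> hom G T"
    by (auto simp: T_def hom_def)
  then obtain h0 where h0: "h0 \<in> hom F T"
    and h0_inl: "\<And>g. g \<in> carrier G \<Longrightarrow> h0 (fp_inl G G g) = (g, g, \<one>\<^bsub>G\<^esub>)"
    and h0_inr: "\<And>g. g \<in> carrier G \<Longrightarrow> h0 (fp_inr G G g) = (\<one>\<^bsub>G\<^esub>, g, g)"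
    unfolding F_def by (rule free_product_lift[OF G G T.is_group]) blast
  interpret h0: group_hom F T h0 by unfold_locales (rule h0)
  define R where "R = (\<lambda>g. commutator F (fp_inl G G g) (fp_inr G G g)) ` carrier G"
  define N where "N = normal_closure F R"
  have S_eq: "S = F Mod N" by (simp add: S_def sidki_double_def F_def N_def R_def)
  have inl_closed: "fp_inl G G g \<in> carrier F" and inr_closed: "fp_inr G G g \<in> carrier F"
    if "g \<in> carrier G" for g
    using that inl inr by (auto simp: hom_def)
  have R: "R \<subseteq> carrier F" by (auto simp: R_def commutator_def inl_closed inr_closed)
  then interpret N: normal N F unfolding N_def by (rule F.normal_closure_normal)
  have "R \<subseteq> kernel F T h0"
  proof
    fix x assume "x \<in> R"
    then obtain g where g: "g \<in> carrier G" "x = commutator F (fp_inl G G g) (fp_inr G G g)"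
      by (auto simp: R_def)
    have "h0 x = inv\<^bsub>T\<^esub> (g, g, \<one>\<^bsub>G\<^esub>) \<otimes>\<^bsub>T\<^esub> inv\<^bsub>T\<^esub> (\<one>\<^bsub>G\<^esub>, g, g) \<otimes>\<^bsub>T\<^esub> (g, g, \<one>\<^bsub>G\<^esub>) \<otimes>\<^bsub>T\<^esub> (\<one>\<^bsub>G\<^esub>, g, g)"
      using g by (simp add: commutator_def inl_closed inr_closed h0_inl h0_inr)
    also have "\<dots> = \<one>\<^bsub>T\<^esub>"
      using g by (simp add: T_def inv_DirProd[OF G] inv_DirProd[OF G G] DirProd_group G
          G.m_assoc G.inv_mult_cancel)
    finally show "x \<in> kernel F T h0" using R \<open>x \<in> R\<close> by (auto simp: kernel_def)
  qed
  then have "N \<subseteq> kernel F T h0"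
    unfolding N_def normal_closure_def using h0.normal_kernel by blast
  with N.normal_axioms obtain h where h: "h \<in> hom S T"
    and h_coset: "\<And>x. x \<in> carrier F \<Longrightarrow> h (N #>\<^bsub>F\<^esub> x) = h0 x"
    unfolding S_eq by (rule h0.FactGroup_universal_kernel) blast
  have \<pi>: "(\<lambda>x. N #>\<^bsub>F\<^esub> x) \<in> hom F S" unfolding S_eq by (rule N.r_coset_hom_Mod)
  define i where "i g = N #>\<^bsub>F\<^esub> fp_inl G G g" for g
  define j where "j g = N #>\<^bsub>F\<^esub> fp_inr G G g" for g
  interpret h: group_hom S T h by unfold_locales (rule h)
  interpret \<pi>: group_hom F S "\<lambda>x. N #>\<^bsub>F\<^esub> x" by unfold_locales (rule \<pi>)
  have carr: "carrier S = (\<lambda>x. N #>\<^bsub>F\<^esub> x) ` carrier F"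
    by (auto simp: S_eq FactGroup_def RCOSETS_def)
  have h_closed: "\<And>x. x \<in> carrier S \<Longrightarrow> h x \<in> carrier T" by simp
  have h_mult: "\<And>x y. x \<in> carrier S \<Longrightarrow> y \<in> carrier S \<Longrightarrow> h (x \<otimes>\<^bsub>S\<^esub> y) = h x \<otimes>\<^bsub>T\<^esub> h y" by simp
  have "commuting_copies S G (\<lambda>x. fst (h x)) (\<lambda>x. snd (snd (h x))) (\<lambda>x. fst (snd (h x))) i j"
  proof
    show "(\<lambda>x. fst (h x)) \<in> hom S G" "(\<lambda>x. snd (snd (h x))) \<in> hom S G"
      "(\<lambda>x. fst (snd (h x))) \<in> hom S G"
      using h_closed
      by (auto intro!: homI simp: h_mult T_def mem_Times_iff DirProd_def split: prod.splits)
    show "i \<in> hom G S" "j \<in> hom G S"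
      using hom_compose[OF inl \<pi>] hom_compose[OF inr \<pi>]
      by (simp_all add: i_def[abs_def] j_def[abs_def] comp_def)
    fix g assume g: "g \<in> carrier G"
    show "fst (h (i g)) = g" "fst (h (j g)) = \<one>\<^bsub>G\<^esub>" "snd (snd (h (i g))) = \<one>\<^bsub>G\<^esub>"
      "snd (snd (h (j g))) = g" "fst (snd (h (i g))) = g" "fst (snd (h (j g))) = g"
      using g by (simp_all add: i_def j_def h_coset inl_closed inr_closed h0_inl h0_inr)
    show "i g \<otimes>\<^bsub>S\<^esub> j g = j g \<otimes>\<^bsub>S\<^esub> i g"
    proof -
      have "commutator F (fp_inl G G g) (fp_inr G G g) \<in> N"
        using g unfolding N_def normal_closure_def R_def by blast
      then have "N #>\<^bsub>F\<^esub> commutator F (fp_inl G G g) (fp_inr G G g) = \<one>\<^bsub>S\<^esub>"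
        using N.rcos_const[OF F.is_group] by (simp add: S_eq FactGroup_def)
      then have "inv\<^bsub>S\<^esub> (j g \<otimes>\<^bsub>S\<^esub> i g) \<otimes>\<^bsub>S\<^esub> (i g \<otimes>\<^bsub>S\<^esub> j g) = \<one>\<^bsub>S\<^esub>"
        using g by (simp add: commutator_def inl_closed inr_closed i_def j_def S.inv_mult_group S.m_assoc)
      then show ?thesis
        using g by (simp add: S.inv_solve_left' i_def j_def inl_closed inr_closed)
    qed
  next
    fix x P
    assume "x \<in> carrier S" and P1: "P \<one>\<^bsub>S\<^esub>"
      and l: "\<And>g x. g \<in> carrier G \<Longrightarrow> x \<in> carrier S \<Longrightarrow> P x \<Longrightarrow> P (i g \<otimes>\<^bsub>S\<^esub> x)"
      and r: "\<And>g x. g \<in> carrier G \<Longrightarrow> x \<in> carrier S \<Longrightarrow> P x \<Longrightarrow> P (j g \<otimes>\<^bsub>S\<^esub> x)"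
    then obtain A where A: "A \<in> carrier F" "x = N #>\<^bsub>F\<^esub> A" using carr by blast
    \<comment> \<open>Generation by the two copies is inherited from the free product along the
      quotient map.\<close>
    have "A \<in> carrier (free_product G G)" using A(1) by (simp add: F_def)
    with G G have "P (N #>\<^bsub>F\<^esub> A)"
    proof (induction rule: free_product_induct)
      case one
      then show ?case using \<pi>.hom_one P1 by (simp add: F_def)
    next
      case (inl g A)
      then show ?case using l[of g "N #>\<^bsub>F\<^esub> A"] inl_closed[of g]
        by (simp flip: F_def) (simp add: i_def)
    next
      case (inr g A)
      then show ?case using r[of g "N #>\<^bsub>F\<^esub> A"] inr_closed[of g]
        by (simp flip: F_def) (simp add: j_def)
    qed
    then show "P x" by (simp add: A)
  qed
  then interpret C: commuting_copies S G
    "\<lambda>x. fst (h x)" "\<lambda>x. snd (snd (h x))" "\<lambda>x. fst (snd (h x))" i j .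
  have "x \<otimes>\<^bsub>S\<^esub> y = y \<otimes>\<^bsub>S\<^esub> x" if "x \<in> kernel S T h" "y \<in> kernel S T h" for x y
    using that by (intro C.kernels_commute) (auto simp: kernel_def T_def)
  with h show ?thesis unfolding S_def T_def by (rule that)
qed


section \<open>Idempotents\<close>

theorem mainTheorem1:
  fixes G :: "('a, 'm) monoid_scheme"
  assumes "group G"
    and "torsion_free (sidki_double G)"
    and "idempotents (group_ring (G \<times>\<times> G \<times>\<times> G)) \<subseteq>
           {\<zero>\<^bsub>group_ring (G \<times>\<times> G \<times>\<times> G)\<^esub>, \<one>\<^bsub>group_ring (G \<times>\<times> G \<times>\<times> G)\<^esub>}"
  shows "idempotents (group_ring (sidki_double G)) \<subseteq>
           {\<zero>\<^bsub>group_ring (sidki_double G)\<^esub>, \<one>\<^bsub>group_ring (sidki_double G)\<^esub>}"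
proof
  define S where "S = sidki_double G"
  define T where "T = G \<times>\<times> G \<times>\<times> G"
  let ?R = "group_ring S"
  interpret S: group S unfolding S_def by (rule group_sidki_double[OF assms(1)])
  interpret T: group T unfolding T_def by (intro DirProd_group assms(1))
  interpret R: ring ?R by (rule S.ring_group_ring)
  obtain h where hom: "h \<in> hom S T"
    and comm: "\<And>x y. x \<in> kernel S T h \<Longrightarrow> y \<in> kernel S T h \<Longrightarrow> x \<otimes>\<^bsub>S\<^esub> y = y \<otimes>\<^bsub>S\<^esub> x"
    using sidki_double_third_power[OF assms(1)] unfolding S_def T_def by blast
  interpret h: group_hom S T h by unfold_locales (rule hom)
  \<comment> \<open>The kernel as a group of its own: commutative by \<open>comm\<close> and
    torsion-free inside \<open>S\<close>, it has enough additive characters to separate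
    points.\<close>
  let ?W = "S\<lparr>carrier := kernel S T h\<rparr>"
  interpret W: comm_group ?W
    using comm by (intro group.group_comm_groupI S.subgroup_imp_group h.subgroup_kernel) simp_all
  have "torsion_free ?W"
    using assms(2) h.subgroup_kernel[THEN subgroup.subset]
    by (auto simp: torsion_free_def S_def[symmetric] S.nat_pow_consistent[symmetric])
  then have sep: "\<exists>l. (\<forall>u\<in>kernel S T h. \<forall>v\<in>kernel S T h. l (u \<otimes>\<^bsub>S\<^esub> v) = l u + l v) \<and> l w \<noteq> (0 :: complex)"
    if "w \<in> kernel S T h" "w \<noteq> \<one>\<^bsub>S\<^esub>" for w
    using W.exists_additive_character[of w] that by simp
  have zero: "e = \<zero>\<^bsub>?R\<^esub>" if "e \<in> idempotents ?R" "pushforward h e = \<zero>\<^bsub>group_ring T\<^esub>" for e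
    using that sep by (rule h.idempotent_eq_zero)
  fix e assume "e \<in> idempotents (group_ring (sidki_double G))"
  then have e: "e \<in> idempotents ?R" by (simp add: S_def)
  then have eR: "e \<in> carrier ?R" and ee: "e \<otimes>\<^bsub>?R\<^esub> e = e" by (auto simp: idempotents_def)
  have "pushforward h e \<in> idempotents (group_ring T)"
    using pushforward_closed[OF hom eR] h.pushforward_mult[OF eR eR] ee
    by (simp add: idempotents_def)
  with assms(3) consider "pushforward h e = \<zero>\<^bsub>group_ring T\<^esub>" | "pushforward h e = \<one>\<^bsub>group_ring T\<^esub>"
    by (auto simp: T_def)
  then have "e \<in> {\<zero>\<^bsub>?R\<^esub>, \<one>\<^bsub>?R\<^esub>}"
  proof cases
    case 1
    with e zero show ?thesis by blast
  next
    case 2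
    let ?f = "\<one>\<^bsub>?R\<^esub> \<ominus>\<^bsub>?R\<^esub> e"
    \<comment> \<open>An expansion valid for every \<open>e\<close>; idempotence then removes the
      subtracted term.\<close>
    have "?f \<otimes>\<^bsub>?R\<^esub> ?f = ?f \<ominus>\<^bsub>?R\<^esub> (e \<ominus>\<^bsub>?R\<^esub> e \<otimes>\<^bsub>?R\<^esub> e)"
      using eR by algebra simp
    also have "\<dots> = ?f" using eR ee by (simp add: R.minus_eq R.r_neg)
    finally have "?f \<in> idempotents ?R" using eR by (simp add: idempotents_def)
    moreover have "pushforward h ?f = \<zero>\<^bsub>group_ring T\<^esub>"
      using eR 2 by (simp add: S.pushforward_minus pushforward_one) (simp add: group_ring_def)
    ultimately have "?f = \<zero>\<^bsub>?R\<^esub>" by (rule zero)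
    then have "e = \<one>\<^bsub>?R\<^esub>" using eR by (simp add: R.r_right_minus_eq)
    then show ?thesis by simp
  qed
  then show "e \<in> {\<zero>\<^bsub>group_ring (sidki_double G)\<^esub>, \<one>\<^bsub>group_ring (sidki_double G)\<^esub>}"
    by (simp add: S_def)
qed

end
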